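(* Let $m\ge 1$ and $n\ge 0$ be integers, and let $\nu_{2l}^{m|0}$, $l=1,2,\ldots$, be a sequence of fundamental solutions of the natural powers of $\Delta_b=-\sum_{j=1}^m\partial_{x_j}^2$ on $\mathbb{R}^m$ satisfying $\Delta_b^j\nu_{2l}^{m|0}=\nu_{2l-2j}^{m|0}$ for $j<l$ and $\Delta_b^l\nu_{2l}^{m|0}=\delta(\underline{x})$. For $l\ge 0$ put $\nu_{2l+1}^{m|0}=\partial_{\underline{x}}\nu_{2l+2}^{m|0}$. Then the function $\nu_1^{m|2n}$ defined by $$\nu_1^{m|2n}=\sum_{k=0}^{n-1}2\,\frac{4^k\,k!}{(n-k-1)!}\,\nu_{2k+2}^{m|0}\,\underline{\grave{x}}^{2n-2k-1}-\sum_{k=0}^n\frac{4^k\,k!}{(n-k)!}\,\nu_{2k+1}^{m|0}\,\underline{\grave{x}}^{2n-2k}$$ is a fundamental solution for the super Dirac operator $\partial_x$, i.e. $\partial_x\,\nu_1^{m|2n}=\delta(x)$ in the distributional sense.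
   Context: Variables: $x_1,\ldots,x_m$ are commuting real variables (coordinates on $\mathbb{R}^m$); $\grave{x}_1,\ldots,\grave{x}_{2n}$ are anticommuting variables ($\grave{x}_i\grave{x}_j=-\grave{x}_j\grave{x}_i$) generating the real Grassmann algebra $\Lambda_{2n}$; the $x_i$ commute with the $\grave{x}_j$. $\mathcal{C}$ is the real associative unital algebra generated by $e_1,\ldots,e_m,\grave{e}_1,\ldots,\grave{e}_{2n}$ with relations $e_je_k+e_ke_j=-2\delta_{jk}$, $\grave{e}_{2j}\grave{e}_{2k}-\grave{e}_{2k}\grave{e}_{2j}=0$, $\grave{e}_{2j-1}\grave{e}_{2k-1}-\grave{e}_{2k-1}\grave{e}_{2j-1}=0$, $\grave{e}_{2j-1}\grave{e}_{2k}-\grave{e}_{2k}\grave{e}_{2j-1}=\delta_{jk}$, $e_j\grave{e}_k+\grave{e}_ke_j=0$. All $e_i,\grave{e}_j$ commute with all $x_i,\grave{x}_j$. Vector variables: $\underline{x}=\sum_{i=1}^m x_ie_i$, $\underline{\grave{x}}=\sum_{j=1}^{2n}\grave{x}_j\grave{e}_j$, $x=\underline{x}+\underline{\grave{x}}$. One has $\underline{\grave{x}}^2=\sum_{j=1}^n\grave{x}_{2j-1}\grave{x}_{2j}$, and $\underline{\grave{x}}^0=1$. Operators: $\partial_{\grave{x}_j}$ is the left derivative on the Grassmann algebra ($\partial_{\grave{x}_j}(\grave{x}_kF)=\delta_{jk}F-\grave{x}_k\partial_{\grave{x}_j}F$), commuting with the $x_i$, $e_i$, $\grave{e}_i$ and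 $\partial_{x_i}$. Put $\partial_{\underline{x}}=\sum_{j=1}^m e_j\partial_{x_j}$ and $\partial_{\underline{\grave{x}}}=2\sum_{j=1}^n\left(\grave{e}_{2j}\partial_{\grave{x}_{2j-1}}-\grave{e}_{2j-1}\partial_{\grave{x}_{2j}}\right)$ (Clifford elements acting by left multiplication). The super Dirac operator is $\partial_x=\partial_{\underline{\grave{x}}}-\partial_{\underline{x}}$. Distributions: operators act on elements of $\mathcal{D}'(\mathbb{R}^m)\otimes\Lambda_{2n}\otimes\mathcal{C}$, with $\partial_{x_j}$ acting in the distributional sense on the first factor. $\delta(\underline{x})$ is the Dirac distribution at the origin of $\mathbb{R}^m$, and the super Dirac distribution is $\delta(x)=\delta(\underline{x})\,\grave{x}_1\cdots\grave{x}_{2n}=\delta(\underline{x})\,\underline{\grave{x}}^{2n}/n!$. Empty sums (when $n=0$) are zero. *)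

theory Defs
  imports "HOL-Analysis.Analysis" "HOL-Library.Poly_Mapping"
begin

section \<open>Distributions on real space\<close>

definition partial :: "'m \<Rightarrow> (real ^ 'm \<Rightarrow> real) \<Rightarrow> real ^ 'm \<Rightarrow> real"
  where "partial j f x = frechet_derivative f (at x) (axis j 1)"

definition smooth :: "(real ^ 'm \<Rightarrow> real) \<Rightarrow> bool"
  where "smooth f \<longleftrightarrow> (\<forall>js x. foldr partial js f differentiable (at x))"

definition support :: "(real ^ 'm \<Rightarrow> real) \<Rightarrow> (real ^ 'm) set"
  where "support f = closure {x. f x \<noteq> 0}"

lemma partial_add:
  assumes "\<And>x. f differentiable at x" "\<And>x. g differentiable at x"
  shows "partial j (\<lambda>x. f x + g x) = (\<lambda>x. partial j f x + partial j g x)"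
proof
  fix x
  have "frechet_derivative (\<lambda>x. f x + g x) (at x)
      = (\<lambda>v. frechet_derivative f (at x) v + frechet_derivative g (at x) v)"
    using assms by (intro frechet_derivative_at[symmetric] has_derivative_add)
      (simp_all add: frechet_derivative_works[symmetric])
  then show "partial j (\<lambda>x. f x + g x) x = partial j f x + partial j g x"
    by (simp add: partial_def)
qed

lemma partial_mult:
  assumes "\<And>x. f differentiable at x"
  shows "partial j (\<lambda>x. c * f x) = (\<lambda>x. c * partial j f x)"
proof
  fix x
  have "frechet_derivative (\<lambda>x. c * f x) (at x) = (\<lambda>v. c * frechet_derivative f (at x) v)"
    using assms by (intro frechet_derivative_at[symmetric] has_derivative_mult_right)
      (simp_all add: frechet_derivative_works[symmetric])
  then show "partial j (\<lambda>x. c * f x) x = c * partial j f x"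
    by (simp add: partial_def)
qed

lemma foldr_partial_add:
  assumes "smooth f" "smooth g"
  shows "foldr partial js (\<lambda>x. f x + g x) = (\<lambda>x. foldr partial js f x + foldr partial js g x)"
  using assms by (induction js) (simp_all add: partial_add smooth_def)

lemma foldr_partial_mult:
  assumes "smooth f"
  shows "foldr partial js (\<lambda>x. c * f x) = (\<lambda>x. c * foldr partial js f x)"
  using assms by (induction js) (simp_all add: partial_mult smooth_def)

lemma foldr_partial_zero: "foldr partial js (\<lambda>x. 0) = (\<lambda>x. 0)"
proof (induction js)
  case (Cons j js)
  then show ?case using partial_mult[of "\<lambda>x. 0" j 0] by simp
qed simp

lemma smooth_zero: "smooth (\<lambda>x. 0)"
  by (simp add: smooth_def foldr_partial_zero)

lemma smooth_add: "smooth f \<Longrightarrow> smooth g \<Longrightarrow> smooth (\<lambda>x. f x + g x)"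
  unfolding smooth_def
  by (subst foldr_partial_add) (auto simp: smooth_def)

lemma smooth_mult: "smooth f \<Longrightarrow> smooth (\<lambda>x. c * f x)"
  unfolding smooth_def
  by (subst foldr_partial_mult) (auto simp: smooth_def)

lemma smooth_partial:
  assumes "smooth f"
  shows "smooth (partial j f)"
proof -
  have "foldr partial js (partial j f) = foldr partial (js @ [j]) f" for js
    by simp
  then show ?thesis
    using assms unfolding smooth_def by metis
qed

lemma compact_support_iff: "compact (support f) \<longleftrightarrow> bounded {x. f x \<noteq> 0}"
  by (simp add: support_def compact_closure)

lemma partial_support: "{x. partial j f x \<noteq> 0} \<subseteq> support f"
proof
  fix x assume x: "x \<in> {x. partial j f x \<noteq> 0}"
  show "x \<in> support f"
  proof (rule ccontr)
    assume "x \<notin> support f"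
    then have "x \<in> - support f" "open (- support f)"
      by (auto simp: support_def open_Compl)
    moreover have "f y = 0" if "y \<in> - support f" for y
      using that closure_subset[of "{x. f x \<noteq> 0}"] by (auto simp: support_def)
    ultimately have "(f has_derivative (\<lambda>_. 0)) (at x)"
      by (intro has_derivative_transform_within_open[of "\<lambda>_. 0" "\<lambda>_. 0" x UNIV "- support f" f]) auto
    then have "frechet_derivative f (at x) = (\<lambda>_. 0)"
      by (metis frechet_derivative_at)
    then show False using x by (simp add: partial_def)
  qed
qed

typedef 'm test_fun = "{f :: real ^ 'm::finite \<Rightarrow> real. smooth f \<and> compact (support f)}"
  morphisms test_app Test_fun
  by (rule exI[of _ "\<lambda>x. 0"]) (simp add: smooth_zero support_def)

setup_lifting type_definition_test_fun

instantiation test_fun :: (finite) real_vector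
begin

lift_definition zero_test_fun :: "'a test_fun" is "\<lambda>x. 0"
  by (simp add: smooth_zero support_def)

lift_definition plus_test_fun :: "'a test_fun \<Rightarrow> 'a test_fun \<Rightarrow> 'a test_fun"
  is "\<lambda>f g x. f x + g x"
  apply (auto simp: smooth_add compact_support_iff)
  subgoal for f g by (rule bounded_subset[of "{x. f x \<noteq> 0} \<union> {x. g x \<noteq> 0}"]) auto
  done

lift_definition scaleR_test_fun :: "real \<Rightarrow> 'a test_fun \<Rightarrow> 'a test_fun"
  is "\<lambda>c f x. c * f x"
  apply (auto simp: smooth_mult compact_support_iff)
  subgoal for c f by (rule bounded_subset[of "{x. f x \<noteq> 0}"]) auto
  done

definition uminus_test_fun :: "'a test_fun \<Rightarrow> 'a test_fun"
  where "uminus_test_fun f = (-1) *\<^sub>R f"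

definition minus_test_fun :: "'a test_fun \<Rightarrow> 'a test_fun \<Rightarrow> 'a test_fun"
  where "minus_test_fun f g = f + (- g)"

instance
  by (standard; (unfold uminus_test_fun_def minus_test_fun_def)?; transfer;
      simp add: algebra_simps fun_eq_iff)

end

lift_definition test_partial :: "'m::finite \<Rightarrow> 'm test_fun \<Rightarrow> 'm test_fun" is partial
  apply (auto simp: smooth_partial compact_support_iff)
  subgoal for j f
    by (rule bounded_subset[OF _ partial_support[of j f]]) (simp add: support_def bounded_closure)
  done

text \<open>Sequential convergence to zero in the space of test functions: all supports lie in one
  compact set, and every iterated partial derivative converges uniformly.\<close>

definition test_null :: "(nat \<Rightarrow> 'm::finite test_fun) \<Rightarrow> bool"
  where "test_null \<phi> \<longleftrightarrow>
    (\<exists>K. compact K \<and> (\<forall>i. support (test_app (\<phi> i)) \<subseteq> K)) \<and>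
    (\<forall>js. uniform_limit UNIV (\<lambda>i. foldr partial js (test_app (\<phi> i))) (\<lambda>x. 0) sequentially)"

lemma test_null_partial:
  assumes "test_null \<phi>"
  shows "test_null (\<lambda>i. test_partial j (\<phi> i))"
proof -
  obtain K where K: "compact K" "\<And>i. support (test_app (\<phi> i)) \<subseteq> K"
    using assms by (auto simp: test_null_def)
  have "support (test_app (test_partial j (\<phi> i))) \<subseteq> K" for i
  proof -
    have "{x. partial j (test_app (\<phi> i)) x \<noteq> 0} \<subseteq> K"
      using partial_support K(2) by blast
    then show ?thesis
      unfolding support_def test_partial.rep_eq
      using K(1) by (simp add: closure_minimal compact_imp_closed)
  qed
  moreover have "uniform_limit UNIV
      (\<lambda>i. foldr partial js (test_app (test_partial j (\<phi> i)))) (\<lambda>x. 0) sequentially" for js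
  proof -
    have "uniform_limit UNIV (\<lambda>i. foldr partial (js @ [j]) (test_app (\<phi> i))) (\<lambda>x. 0) sequentially"
      using assms unfolding test_null_def by blast
    then show ?thesis by (simp add: test_partial.rep_eq)
  qed
  ultimately show ?thesis
    using K(1) unfolding test_null_def by blast
qed

lemma test_partial_add: "test_partial j (f + g) = test_partial j f + test_partial j g"
  by transfer (auto intro!: partial_add simp: smooth_def dest: spec[of _ "[]"])

lemma test_partial_scaleR: "test_partial j (c *\<^sub>R f) = c *\<^sub>R test_partial j f"
  by transfer (auto intro!: partial_mult simp: smooth_def dest: spec[of _ "[]"])

typedef 'm distribution = "{T :: 'm::finite test_fun \<Rightarrow> real.
    linear T \<and> (\<forall>\<phi>. test_null \<phi> \<longrightarrow> (\<lambda>i. T (\<phi> i)) \<longlonglongrightarrow> 0)}"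
  morphisms dist_app Distribution
  by (rule exI[of _ "\<lambda>_. 0"]) (simp add: linear_zero)

setup_lifting type_definition_distribution

instantiation distribution :: (finite) real_vector
begin

lift_definition zero_distribution :: "'a distribution" is "\<lambda>\<phi>. 0"
  by (simp add: linear_zero)

lift_definition plus_distribution :: "'a distribution \<Rightarrow> 'a distribution \<Rightarrow> 'a distribution"
  is "\<lambda>S T \<phi>. S \<phi> + T \<phi>"
  by (auto intro: linear_compose_add tendsto_add_zero)

lift_definition scaleR_distribution :: "real \<Rightarrow> 'a distribution \<Rightarrow> 'a distribution"
  is "\<lambda>c T \<phi>. c * T \<phi>"
  by (auto intro: linear_compose_scale_right[where 'b = real, simplified] tendsto_mult_right_zero)

definition uminus_distribution :: "'a distribution \<Rightarrow> 'a distribution"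
  where "uminus_distribution T = (-1) *\<^sub>R T"

definition minus_distribution :: "'a distribution \<Rightarrow> 'a distribution \<Rightarrow> 'a distribution"
  where "minus_distribution S T = S + (- T)"

instance
  by (standard; (unfold uminus_distribution_def minus_distribution_def)?; transfer;
      simp add: algebra_simps fun_eq_iff)

end

lift_definition dist_deriv :: "'m::finite \<Rightarrow> 'm distribution \<Rightarrow> 'm distribution"
  is "\<lambda>j T \<phi>. - T (test_partial j \<phi>)"
proof (intro CollectI conjI allI impI)
  fix j :: 'm and T :: "'m test_fun \<Rightarrow> real"
  assume "linear T \<and> (\<forall>\<phi>. test_null \<phi> \<longrightarrow> (\<lambda>i. T (\<phi> i)) \<longlonglongrightarrow> 0)"
  then have T: "linear T" "\<And>\<phi>. test_null \<phi> \<Longrightarrow> (\<lambda>i. T (\<phi> i)) \<longlonglongrightarrow> 0" by auto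
  show "linear (\<lambda>\<phi>. - T (test_partial j \<phi>))"
    by (rule linearI)
       (simp_all add: test_partial_add test_partial_scaleR linear_add[OF T(1)] linear_scale[OF T(1)])
  fix \<phi> :: "nat \<Rightarrow> 'm test_fun" assume "test_null \<phi>"
  then show "(\<lambda>i. - T (test_partial j (\<phi> i))) \<longlonglongrightarrow> 0"
    using T(2)[OF test_null_partial[of \<phi> j]] tendsto_minus by fastforce
qed

lift_definition dirac :: "'m::finite distribution" is "\<lambda>\<phi>. test_app \<phi> 0"
proof (intro CollectI conjI allI impI)
  show "linear (\<lambda>\<phi> :: 'm test_fun. test_app \<phi> 0)"
    by (rule linearI) (simp_all add: plus_test_fun.rep_eq scaleR_test_fun.rep_eq)
  fix \<phi> :: "nat \<Rightarrow> 'm test_fun" assume "test_null \<phi>"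
  then have "uniform_limit UNIV (\<lambda>i. foldr partial [] (test_app (\<phi> i))) (\<lambda>x. 0) sequentially"
    unfolding test_null_def by blast
  then show "(\<lambda>i. test_app (\<phi> i) 0) \<longlonglongrightarrow> 0"
    by (auto dest: tendsto_uniform_limitI[where x = 0])
qed

definition laplace_b :: "'m::finite distribution \<Rightarrow> 'm distribution"
  where "laplace_b T = - (\<Sum>j\<in>UNIV. dist_deriv j (dist_deriv j T))"

section \<open>Free algebras as real algebras\<close>

datatype 'a fword = FWord (letters: "'a list")

instantiation fword :: (type) monoid_add
begin

definition zero_fword :: "'a fword" where "zero_fword = FWord []"

definition plus_fword :: "'a fword \<Rightarrow> 'a fword \<Rightarrow> 'a fword"
  where "plus_fword u v = FWord (letters u @ letters v)"

instance
  by standard (simp_all add: zero_fword_def plus_fword_def)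

end

instantiation poly_mapping :: (type, real_vector) real_vector
begin

lift_definition scaleR_poly_mapping :: "real \<Rightarrow> ('a \<Rightarrow>\<^sub>0 'b) \<Rightarrow> 'a \<Rightarrow>\<^sub>0 'b"
  is "\<lambda>r f k. r *\<^sub>R f k"
  by (erule finite_subset[rotated]) auto

instance
  by standard (transfer, simp add: fun_eq_iff scaleR_add_right scaleR_add_left)+

end

lemma lookup_scaleR: "Poly_Mapping.lookup (r *\<^sub>R f) k = r *\<^sub>R Poly_Mapping.lookup f k"
  by transfer simp

lemma scaleR_single: "r *\<^sub>R Poly_Mapping.single k x = Poly_Mapping.single k (r *\<^sub>R x)"
  by (rule poly_mapping_eqI) (simp add: lookup_scaleR lookup_single when_def)

lemma keys_scaleR: "Poly_Mapping.keys (r *\<^sub>R f) \<subseteq> Poly_Mapping.keys f"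
  by (auto simp: in_keys_iff lookup_scaleR)

lemma poly_mapping_expand:
  "f = (\<Sum>k\<in>Poly_Mapping.keys f. Poly_Mapping.single k (Poly_Mapping.lookup f k))"
  by (rule poly_mapping_eqI)
     (simp add: lookup_sum lookup_single when_def in_keys_iff)

lemma poly_mapping_mult_expand:
  "f * g = (\<Sum>k\<in>Poly_Mapping.keys f. \<Sum>l\<in>Poly_Mapping.keys g.
      Poly_Mapping.single (k + l) (Poly_Mapping.lookup f k * Poly_Mapping.lookup g l))"
proof -
  have "f * g = (\<Sum>k\<in>Poly_Mapping.keys f. Poly_Mapping.single k (Poly_Mapping.lookup f k))
      * (\<Sum>l\<in>Poly_Mapping.keys g. Poly_Mapping.single l (Poly_Mapping.lookup g l))"
    by (rule arg_cong2[where f = "(*)", OF poly_mapping_expand poly_mapping_expand])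
  then show ?thesis by (simp add: sum_product mult_single)
qed

instance poly_mapping :: (monoid_add, real_algebra) real_algebra
proof
  fix r :: real and f g :: "'a \<Rightarrow>\<^sub>0 'b"
  show "r *\<^sub>R f * g = r *\<^sub>R (f * g)"
  proof (cases "r = 0")
    case False
    then have "Poly_Mapping.keys (r *\<^sub>R f) = Poly_Mapping.keys f"
      by (auto simp: in_keys_iff lookup_scaleR)
    then show ?thesis
      unfolding poly_mapping_mult_expand[of "r *\<^sub>R f"] poly_mapping_mult_expand[of f]
      by (simp add: scaleR_sum_right scaleR_single lookup_scaleR)
  qed simp
  show "f * r *\<^sub>R g = r *\<^sub>R (f * g)"
  proof (cases "r = 0")
    case False
    then have "Poly_Mapping.keys (r *\<^sub>R g) = Poly_Mapping.keys g"
      by (auto simp: in_keys_iff lookup_scaleR)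
    then show ?thesis
      unfolding poly_mapping_mult_expand[of f]
      by (simp add: scaleR_sum_right scaleR_single lookup_scaleR)
  qed simp
qed

instance poly_mapping :: (monoid_add, real_algebra_1) real_algebra_1 ..

section \<open>The super algebra\<close>

datatype 'm clifford_gen = E 'm | W nat

text \<open>The free algebra on the Grassmann generators tensored with the free algebra on the
  Clifford-Weyl generators: a basis word is a pair of words, one from each factor, so that
  letters of different factors commute.\<close>

type_synonym 'm bword = "nat fword \<times> 'm clifford_gen fword"
type_synonym 'm super_poly = "'m bword \<Rightarrow>\<^sub>0 real"

text \<open>\<open>gx j\<close>, \<open>ce j\<close> and \<open>we j\<close> are the anticommuting variables, the orthogonal Clifford
  generators and the symplectic (Weyl) generators.\<close>

definition gx :: "nat \<Rightarrow> 'm super_poly"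
  where "gx j = Poly_Mapping.single (FWord [j], 0) 1"

definition ce :: "'m \<Rightarrow> 'm super_poly"
  where "ce j = Poly_Mapping.single (0, FWord [E j]) 1"

definition we :: "nat \<Rightarrow> 'm super_poly"
  where "we j = Poly_Mapping.single (0, FWord [W j]) 1"

definition super_words :: "nat \<Rightarrow> 'm bword set"
  where "super_words n = {w. set (letters (fst w)) \<subseteq> {1..2*n} \<and>
    set (letters (snd w)) \<subseteq> range E \<union> W ` {1..2*n}}"

definition free_super :: "nat \<Rightarrow> 'm super_poly set"
  where "free_super n = {a. Poly_Mapping.keys a \<subseteq> super_words n}"

definition super_relators :: "nat \<Rightarrow> 'm super_poly set"
  where "super_relators n =
    {gx j * gx k + gx k * gx j | j k. j \<in> {1..2*n} \<and> k \<in> {1..2*n}} \<union>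
    {ce j * ce k + ce k * ce j + (if j = k then 2 else 0) | j k. True} \<union>
    {we (2*j) * we (2*k) - we (2*k) * we (2*j) | j k. j \<in> {1..n} \<and> k \<in> {1..n}} \<union>
    {we (2*j-1) * we (2*k-1) - we (2*k-1) * we (2*j-1) | j k. j \<in> {1..n} \<and> k \<in> {1..n}} \<union>
    {we (2*j-1) * we (2*k) - we (2*k) * we (2*j-1) - (if j = k then 1 else 0)
      | j k. j \<in> {1..n} \<and> k \<in> {1..n}} \<union>
    {ce j * we k + we k * ce j | j k. k \<in> {1..2*n}}"

text \<open>The two-sided ideal by which \<^term>\<open>free_super n\<close> has to be divided in order to
  obtain the tensor product of the Grassmann algebra and the Clifford-Weyl algebra.\<close>

definition super_ideal :: "nat \<Rightarrow> 'm super_poly set"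
  where "super_ideal n =
    span {a * r * b | a r b. a \<in> free_super n \<and> r \<in> super_relators n \<and> b \<in> free_super n}"

primrec grassmann_deriv_word :: "nat \<Rightarrow> nat list \<Rightarrow> 'm clifford_gen fword \<Rightarrow> 'm super_poly"
  where
    "grassmann_deriv_word j [] c = 0"
  | "grassmann_deriv_word j (k # g) c =
      (if j = k then Poly_Mapping.single (FWord g, c) 1 else 0) - gx k * grassmann_deriv_word j g c"

definition grassmann_deriv :: "nat \<Rightarrow> 'm super_poly \<Rightarrow> 'm super_poly"
  where "grassmann_deriv j a = (\<Sum>w\<in>Poly_Mapping.keys a.
    Poly_Mapping.lookup a w *\<^sub>R grassmann_deriv_word j (letters (fst w)) (snd w))"

section \<open>Distributions with values in the super algebra\<close>

text \<open>The tensor product of the distributions with the free algebra consists of the finitely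
  supported families of distributions indexed by words; the one over a fixed \<open>n\<close> has to be divided
  by the distributions tensored with the ideal.\<close>

type_synonym 'm superdist_poly = "'m bword \<Rightarrow>\<^sub>0 'm distribution"

definition tensor :: "'m::finite distribution \<Rightarrow> 'm super_poly \<Rightarrow> 'm superdist_poly" (infixr \<open>\<otimes>\<^sub>s\<close> 75)
  where "T \<otimes>\<^sub>s a = Poly_Mapping.map (\<lambda>r. r *\<^sub>R T) a"

text \<open>The operator on the tensor product that is induced by a linear operator on each factor.\<close>

definition tensor_op :: "('m::finite distribution \<Rightarrow> 'm distribution) \<Rightarrow>
    ('m super_poly \<Rightarrow> 'm super_poly) \<Rightarrow> 'm superdist_poly \<Rightarrow> 'm superdist_poly"
  where "tensor_op D H u = (\<Sum>w\<in>Poly_Mapping.keys u.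
    D (Poly_Mapping.lookup u w) \<otimes>\<^sub>s H (Poly_Mapping.single w 1))"

definition free_superdist :: "nat \<Rightarrow> 'm::finite superdist_poly set"
  where "free_superdist n = {u. Poly_Mapping.keys u \<subseteq> super_words n}"

definition superdist_null :: "nat \<Rightarrow> 'm::finite superdist_poly set"
  where "superdist_null n = span {T \<otimes>\<^sub>s r | T r. r \<in> super_ideal n}"

text \<open>Two representatives are related iff they denote the same element of the tensor product of the
  distributions, the Grassmann algebra and the Clifford-Weyl algebra.\<close>

definition superdist_rel :: "nat \<Rightarrow> ('m::finite superdist_poly \<times> 'm superdist_poly) set"
  where "superdist_rel n =
    {(u, v). u \<in> free_superdist n \<and> v \<in> free_superdist n \<and> u - v \<in> superdist_null n}"

definition superdist_class :: "nat \<Rightarrow> 'm::finite superdist_poly \<Rightarrow> 'm superdist_poly set"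
  where "superdist_class n u = superdist_rel n `` {u}"

definition superdist :: "nat \<Rightarrow> 'm::finite superdist_poly set set"
  where "superdist n = free_superdist n // superdist_rel n"

definition bosonic_dirac :: "'m::finite superdist_poly \<Rightarrow> 'm superdist_poly"
  where "bosonic_dirac u = (\<Sum>j\<in>UNIV. tensor_op (dist_deriv j) (\<lambda>a. ce j * a) u)"

definition fermionic_dirac :: "nat \<Rightarrow> 'm::finite superdist_poly \<Rightarrow> 'm superdist_poly"
  where "fermionic_dirac n u = 2 *\<^sub>R (\<Sum>j=1..n.
    tensor_op (\<lambda>T. T) (\<lambda>a. we (2*j) * grassmann_deriv (2*j-1) a) u -
    tensor_op (\<lambda>T. T) (\<lambda>a. we (2*j-1) * grassmann_deriv (2*j) a) u)"

definition free_super_dirac :: "nat \<Rightarrow> 'm::finite superdist_poly \<Rightarrow> 'm superdist_poly"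
  where "free_super_dirac n u = fermionic_dirac n u - bosonic_dirac u"

text \<open>The induced operator on the quotient; the union is over equal classes, see
  \<open>super_dirac_class\<close> below.\<close>

definition super_dirac :: "nat \<Rightarrow> 'm::finite superdist_poly set \<Rightarrow> 'm superdist_poly set"
  where "super_dirac n X = (\<Union>u\<in>X. superdist_class n (free_super_dirac n u))"

definition fermionic_vector :: "nat \<Rightarrow> 'm super_poly"
  where "fermionic_vector n = (\<Sum>j=1..2*n. gx j * we j)"

definition super_delta :: "nat \<Rightarrow> 'm::finite superdist_poly"
  where "super_delta n = dirac \<otimes>\<^sub>s prod_list (map gx [1..<2*n+1])"

text \<open>Given the distributions of even index, \<^term>\<open>odd_fundamental \<nu> l\<close> is the one of
  index \<open>2l + 1\<close>.\<close>

definition odd_fundamental :: "(nat \<Rightarrow> 'm::finite distribution) \<Rightarrow> nat \<Rightarrow> 'm superdist_poly"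
  where "odd_fundamental \<nu> l = bosonic_dirac (\<nu> (2*l+2) \<otimes>\<^sub>s 1)"

definition super_fundamental :: "nat \<Rightarrow> (nat \<Rightarrow> 'm::finite distribution) \<Rightarrow> 'm superdist_poly"
  where "super_fundamental n \<nu> =
    (\<Sum>k<n. (2 * (4 ^ k * fact k / fact (n - k - 1))) *\<^sub>R
      (\<nu> (2*k+2) \<otimes>\<^sub>s fermionic_vector n ^ (2*n - 2*k - 1))) -
    (\<Sum>k\<le>n. (4 ^ k * fact k / fact (n - k)) *\<^sub>R
      tensor_op (\<lambda>T. T) (\<lambda>a. a * fermionic_vector n ^ (2*n - 2*k)) (odd_fundamental \<nu> k))"

section \<open>Well-definedness on the quotient\<close>

lemma lookup_tensor: "Poly_Mapping.lookup (T \<otimes>\<^sub>s a) w = Poly_Mapping.lookup a w *\<^sub>R T"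
  by (simp add: tensor_def Poly_Mapping.map.rep_eq when_def)

lemma linear_tensor: "linear (\<lambda>a. T \<otimes>\<^sub>s a)"
  by (rule linearI; rule poly_mapping_eqI)
     (simp_all add: lookup_tensor lookup_add lookup_scaleR scaleR_add_left)

lemma linear_tensor_left: "linear (\<lambda>T. T \<otimes>\<^sub>s a)"
  by (rule linearI; rule poly_mapping_eqI)
     (simp_all add: lookup_tensor lookup_add lookup_scaleR scaleR_add_right)

lemma keys_tensor: "Poly_Mapping.keys (T \<otimes>\<^sub>s a) \<subseteq> Poly_Mapping.keys a"
  by (auto simp: in_keys_iff lookup_tensor)

lemma sum_keys_superset:
  assumes "finite S" "Poly_Mapping.keys u \<subseteq> S" "\<And>w. f w 0 = 0"
  shows "(\<Sum>w\<in>Poly_Mapping.keys u. f w (Poly_Mapping.lookup u w)) = (\<Sum>w\<in>S. f w (Poly_Mapping.lookup u w))"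
  using assms by (intro sum.mono_neutral_left) (auto simp: in_keys_iff)

lemma linear_sum_keys:
  fixes f :: "'k \<Rightarrow> 'a::real_vector \<Rightarrow> 'b::real_vector"
  assumes f: "\<And>w. linear (f w)"
  shows "linear (\<lambda>u. \<Sum>w\<in>Poly_Mapping.keys u. f w (Poly_Mapping.lookup u w))"
proof (rule linearI)
  note z = linear_0[OF f]
  fix u v :: "'k \<Rightarrow>\<^sub>0 'a" and r :: real
  let ?S = "Poly_Mapping.keys u \<union> Poly_Mapping.keys v"
  have S: "finite ?S" "Poly_Mapping.keys u \<subseteq> ?S" "Poly_Mapping.keys v \<subseteq> ?S" "Poly_Mapping.keys (u + v) \<subseteq> ?S"
    using Poly_Mapping.keys_add[of u v] by auto
  show "(\<Sum>w\<in>Poly_Mapping.keys (u + v). f w (Poly_Mapping.lookup (u + v) w)) =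
      (\<Sum>w\<in>Poly_Mapping.keys u. f w (Poly_Mapping.lookup u w)) +
      (\<Sum>w\<in>Poly_Mapping.keys v. f w (Poly_Mapping.lookup v w))"
    using sum_keys_superset[OF S(1) S(2), of f] sum_keys_superset[OF S(1) S(3), of f]
      sum_keys_superset[OF S(1) S(4), of f] z
    by (simp add: lookup_add linear_add[OF f] sum.distrib)
  show "(\<Sum>w\<in>Poly_Mapping.keys (r *\<^sub>R u). f w (Poly_Mapping.lookup (r *\<^sub>R u) w)) =
      r *\<^sub>R (\<Sum>w\<in>Poly_Mapping.keys u. f w (Poly_Mapping.lookup u w))"
    using sum_keys_superset[OF finite_keys keys_scaleR[of r u], of f] z
    by (simp add: lookup_scaleR linear_scale[OF f] scaleR_sum_right)
qed

lemma linear_tensor_op: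
  assumes "linear D"
  shows "linear (tensor_op D H)"
proof -
  have "linear (\<lambda>x. D x \<otimes>\<^sub>s H (Poly_Mapping.single w 1))" for w
    using linear_compose[OF assms linear_tensor_left] by (simp add: o_def)
  from linear_sum_keys[OF this] show ?thesis
    by (simp add: tensor_op_def[abs_def])
qed

lemma linear_expand_words:
  fixes H :: "('k \<Rightarrow>\<^sub>0 real) \<Rightarrow> 'b::real_vector"
  assumes "linear H"
  shows "H a = (\<Sum>w\<in>Poly_Mapping.keys a. Poly_Mapping.lookup a w *\<^sub>R H (Poly_Mapping.single w 1))"
proof -
  have "H a = H (\<Sum>w\<in>Poly_Mapping.keys a. Poly_Mapping.lookup a w *\<^sub>R Poly_Mapping.single w 1)"
    by (rule arg_cong[where f = H]) (simp add: scaleR_single poly_mapping_expand[symmetric])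
  then show ?thesis by (simp add: linear_sum[OF assms] linear_scale[OF assms])
qed

lemma linear_eq_words:
  fixes F G :: "('k \<Rightarrow>\<^sub>0 real) \<Rightarrow> 'b::real_vector"
  assumes "linear F" "linear G" "\<And>w. F (Poly_Mapping.single w 1) = G (Poly_Mapping.single w 1)"
  shows "F a = G a"
  using linear_expand_words[OF assms(1), of a] linear_expand_words[OF assms(2), of a] assms(3) by simp

lemma tensor_op_tensor:
  assumes D: "linear D" and H: "linear H"
  shows "tensor_op D H (T \<otimes>\<^sub>s a) = D T \<otimes>\<^sub>s H a"
proof -
  have "tensor_op D H (T \<otimes>\<^sub>s a) = (\<Sum>w\<in>Poly_Mapping.keys a.
      D (Poly_Mapping.lookup a w *\<^sub>R T) \<otimes>\<^sub>s H (Poly_Mapping.single w 1))"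
    unfolding tensor_op_def lookup_tensor[symmetric]
    by (rule sum_keys_superset) (use keys_tensor linear_0[OF D] linear_0[OF linear_tensor_left] in auto)
  also have "\<dots> = D T \<otimes>\<^sub>s (\<Sum>w\<in>Poly_Mapping.keys a. Poly_Mapping.lookup a w *\<^sub>R H (Poly_Mapping.single w 1))"
    by (simp add: linear_scale[OF D] linear_scale[OF linear_tensor_left]
        linear_scale[OF linear_tensor] linear_sum[OF linear_tensor])
  finally show ?thesis using linear_expand_words[OF H, of a] by simp
qed

lemma linear_dist_deriv: "linear (dist_deriv j)"
  by (rule linearI; transfer) (auto simp: fun_eq_iff)

lemma linear_scaleR_left': "linear (\<lambda>x::real. x *\<^sub>R v)"
  by (rule linearI) (simp_all add: scaleR_add_left)

lemma linear_grassmann_deriv: "linear (grassmann_deriv j)"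
proof -
  have "linear (\<lambda>x::real. x *\<^sub>R grassmann_deriv_word j (letters (fst w)) (snd w))" for w
    by (rule linear_scaleR_left')
  from linear_sum_keys[OF this] show ?thesis
    by (simp add: grassmann_deriv_def[abs_def])
qed

lemma grassmann_deriv_single:
  "grassmann_deriv j (Poly_Mapping.single w 1) = grassmann_deriv_word j (letters (fst w)) (snd w)"
  by (simp add: grassmann_deriv_def)

definition grade_involution :: "'m super_poly \<Rightarrow> 'm super_poly"
  where "grade_involution a = (\<Sum>w\<in>Poly_Mapping.keys a.
    Poly_Mapping.lookup a w *\<^sub>R ((-1) ^ length (letters (fst w)) *\<^sub>R Poly_Mapping.single w 1))"

lemma linear_grade_involution: "linear grade_involution"
proof -
  have "linear (\<lambda>x::real. x *\<^sub>R ((-1) ^ length (letters (fst w)) *\<^sub>R Poly_Mapping.single w (1::real)))" for w :: "'m bword"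
    by (rule linear_scaleR_left')
  from linear_sum_keys[OF this] show ?thesis
    by (simp add: grade_involution_def[abs_def])
qed

lemma grade_involution_single:
  "grade_involution (Poly_Mapping.single w 1) = (-1) ^ length (letters (fst w)) *\<^sub>R Poly_Mapping.single w 1"
  by (simp add: grade_involution_def)

lemma FWord_add: "FWord g + FWord h = FWord (g @ h)"
  by (simp add: plus_fword_def)

lemma grassmann_deriv_word_append:
  "grassmann_deriv_word j (g @ h) (c + d) =
    grassmann_deriv_word j g c * Poly_Mapping.single (FWord h, d) 1 +
    (-1) ^ length g *\<^sub>R (Poly_Mapping.single (FWord g, c) 1 * grassmann_deriv_word j h d)"
proof (induction g)
  case Nil
  have "grassmann_deriv_word j h (c + d) = Poly_Mapping.single (0, c) 1 * grassmann_deriv_word j h d"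
  proof (induction h)
    case (Cons k h)
    have "gx k * Poly_Mapping.single (0, c) 1 = Poly_Mapping.single (0, c) 1 * gx k"
      by (simp add: gx_def mult_single)
    moreover have "Poly_Mapping.single (FWord h, c + d) (1::real)
        = Poly_Mapping.single (0, c) 1 * Poly_Mapping.single (FWord h, d) 1"
      by (simp add: mult_single)
    ultimately show ?case
      by (simp add: Cons.IH right_diff_distrib mult.assoc[symmetric])
  qed simp
  then show ?case by (simp add: zero_fword_def)
next
  case (Cons k g)
  have "gx k * Poly_Mapping.single (FWord g, c) 1 = Poly_Mapping.single (FWord (k # g), c) 1"
    by (simp add: gx_def mult_single plus_fword_def zero_fword_def)
  then show ?case
    by (simp add: Cons.IH left_diff_distrib right_diff_distrib distrib_left mult_single
        FWord_add mult.assoc[symmetric])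
qed

lemma grassmann_deriv_mult:
  "grassmann_deriv j (a * b) = grassmann_deriv j a * b + grade_involution a * grassmann_deriv j b"
proof -
  have w: "grassmann_deriv j (Poly_Mapping.single v 1 * Poly_Mapping.single w 1) =
      grassmann_deriv j (Poly_Mapping.single v 1) * Poly_Mapping.single w 1 +
      grade_involution (Poly_Mapping.single v 1) * grassmann_deriv j (Poly_Mapping.single w 1)" for v w
    using grassmann_deriv_word_append[of j "letters (fst v)" "letters (fst w)" "snd v" "snd w"]
    by (simp add: mult_single grassmann_deriv_single grade_involution_single plus_fword_def)
  note [simp] = linear_add[OF linear_grassmann_deriv] linear_scale[OF linear_grassmann_deriv]
    linear_add[OF linear_grade_involution] linear_scale[OF linear_grade_involution]
  have 1: "grassmann_deriv j (Poly_Mapping.single v 1 * b) =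
      grassmann_deriv j (Poly_Mapping.single v 1) * b +
      grade_involution (Poly_Mapping.single v 1) * grassmann_deriv j b" for v
    by (rule linear_eq_words[of _ _ b]; (rule linearI)?) (simp_all add: w algebra_simps)
  show ?thesis
    by (rule linear_eq_words[of _ _ a]; (rule linearI)?) (simp_all add: 1 algebra_simps)
qed

lemma subspace_keys: "subspace {u. Poly_Mapping.keys u \<subseteq> S}"
proof (rule subspaceI)
  show "u + v \<in> {u. Poly_Mapping.keys u \<subseteq> S}"
    if "u \<in> {u. Poly_Mapping.keys u \<subseteq> S}" "v \<in> {u. Poly_Mapping.keys u \<subseteq> S}" for u v
    using that Poly_Mapping.keys_add[of u v] by blast
  show "r *\<^sub>R u \<in> {u. Poly_Mapping.keys u \<subseteq> S}" if "u \<in> {u. Poly_Mapping.keys u \<subseteq> S}" for r u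
    using that keys_scaleR[of r u] by blast
qed simp

lemma subspace_free_super: "subspace (free_super n)"
  unfolding free_super_def by (rule subspace_keys)

lemma subspace_free_superdist: "subspace (free_superdist n)"
  unfolding free_superdist_def by (rule subspace_keys)

lemma subspace_super_ideal: "subspace (super_ideal n)"
  unfolding super_ideal_def by (rule subspace_span)

lemma subspace_superdist_null: "subspace (superdist_null n)"
  unfolding superdist_null_def by (rule subspace_span)

lemma super_words_add: "v \<in> super_words n \<Longrightarrow> w \<in> super_words n \<Longrightarrow> v + w \<in> super_words n"
  by (auto simp: super_words_def plus_fword_def)

lemma free_super_mult: "a \<in> free_super n \<Longrightarrow> b \<in> free_super n \<Longrightarrow> a * b \<in> free_super n"
  unfolding free_super_def using Poly_Mapping.keys_mult[of a b] super_words_add by blast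

lemma free_super_gens:
  "1 \<in> free_super n" "j \<in> {1..2*n} \<Longrightarrow> gx j \<in> free_super n"
  "ce i \<in> free_super n" "j \<in> {1..2*n} \<Longrightarrow> we j \<in> free_super n"
  by (auto simp: free_super_def gx_def ce_def we_def super_words_def zero_fword_def)

lemma free_super_power: "a \<in> free_super n \<Longrightarrow> a ^ k \<in> free_super n"
  by (induction k) (auto simp: free_super_gens free_super_mult)

lemma free_super_relators: "(super_relators n :: 'm super_poly set) \<subseteq> free_super n"
proof -
  note s = subspace_free_super[of n]
  have "1 + 1 \<in> (free_super n :: 'm super_poly set)"
    by (intro subspace_add[OF s] free_super_gens)
  then have 2: "(if j = k then 2 else 0) \<in> (free_super n :: 'm super_poly set)" for j k :: 'k
    by (simp add: subspace_0[OF s])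
  have 1: "(if j = k then 1 else 0) \<in> (free_super n :: 'm super_poly set)" for j k :: 'k
    by (simp add: subspace_0[OF s] free_super_gens)
  have even: "2 * j \<in> {1..2*n}" and odd: "2 * j - 1 \<in> {1..2*n}" if "j \<in> {1..n}" for j
    using that by auto
  show ?thesis
    unfolding super_relators_def
    by (intro Un_least subsetI; elim CollectE exE conjE; hypsubst;
        intro subspace_add[OF s] subspace_diff[OF s] free_super_mult free_super_gens 1 2;
        (rule even odd)?; assumption)
qed

lemma free_super_ideal: "super_ideal n \<subseteq> free_super n"
  unfolding super_ideal_def
  using free_super_relators[of n]
  by (intro span_minimal subspace_free_super) (auto intro!: free_super_mult)

lemma super_ideal_gen:
  "a \<in> free_super n \<Longrightarrow> r \<in> super_relators n \<Longrightarrow> b \<in> free_super n \<Longrightarrow> a * r * b \<in> super_ideal n"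
  unfolding super_ideal_def by (intro span_base) blast

lemma linear_image_span:
  assumes "linear H" "subspace V" "\<And>x. x \<in> S \<Longrightarrow> H x \<in> V" "x \<in> span S"
  shows "H x \<in> V"
proof -
  have "H ` span S \<subseteq> V"
    unfolding linear_span_image[OF assms(1), symmetric]
    using assms(2,3) by (intro span_minimal) auto
  then show ?thesis using assms(4) by auto
qed

lemma super_ideal_mult_left:
  assumes "a \<in> free_super n" "x \<in> super_ideal n"
  shows "a * x \<in> super_ideal n"
  using assms(2) unfolding super_ideal_def[of n]
proof (rule linear_image_span[where H = "\<lambda>x. a * x", rotated 3])
  show "linear (\<lambda>x. a * x)" by (rule linearI) (simp_all add: algebra_simps)
qed (use assms(1) in \<open>auto simp: mult.assoc[symmetric] intro!: span_base\<close>,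
     use free_super_mult in \<open>metis mult.assoc\<close>)

lemma super_ideal_mult_right:
  assumes "a \<in> free_super n" "x \<in> super_ideal n"
  shows "x * a \<in> super_ideal n"
  using assms(2) unfolding super_ideal_def[of n]
proof (rule linear_image_span[where H = "\<lambda>x. x * a", rotated 3])
  show "linear (\<lambda>x. x * a)" by (rule linearI) (simp_all add: algebra_simps)
qed (use assms(1) in \<open>auto simp: mult.assoc intro!: span_base\<close>,
     use free_super_mult in \<open>metis mult.assoc\<close>)


lemma grade_involution_mult:
  "grade_involution (a * b) = grade_involution a * grade_involution b"
proof -
  note [simp] = linear_add[OF linear_grade_involution] linear_scale[OF linear_grade_involution]
  have w: "grade_involution (Poly_Mapping.single v 1 * Poly_Mapping.single w 1) =
      grade_involution (Poly_Mapping.single v 1) * grade_involution (Poly_Mapping.single w 1)" for v w :: "'a bword"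
    by (simp add: mult_single grade_involution_single plus_fword_def power_add)
  have 1: "grade_involution (Poly_Mapping.single v 1 * b) =
      grade_involution (Poly_Mapping.single v 1) * grade_involution b" for v
    by (rule linear_eq_words[of _ _ b]; (rule linearI)?) (simp_all add: w algebra_simps)
  show ?thesis
    by (rule linear_eq_words[of _ _ a]; (rule linearI)?) (simp_all add: 1 algebra_simps)
qed

lemma grade_involution_gens:
  "grade_involution 1 = 1" "grade_involution (gx j) = - gx j"
  "grade_involution (ce i) = ce i" "grade_involution (we j) = we j"
  using grade_involution_single[of 0]
  by (auto simp: gx_def ce_def we_def grade_involution_single zero_fword_def)

lemma single_FWord_Nil: "Poly_Mapping.single (FWord [], FWord []) 1 = 1"
  by (metis single_one zero_fword_def zero_prod_def)

lemma grassmann_deriv_one: "grassmann_deriv j 1 = 0"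
  by (simp add: grassmann_deriv_def zero_fword_def)

lemma grassmann_deriv_gens:
  "grassmann_deriv j 1 = 0" "grassmann_deriv j (gx k) = (if j = k then 1 else 0)"
  "grassmann_deriv j (ce i) = 0" "grassmann_deriv j (we k) = 0"
  by (simp_all add: gx_def ce_def we_def grassmann_deriv_single grassmann_deriv_one
      zero_fword_def single_FWord_Nil)

lemma relator_grade: "r \<in> super_relators n \<Longrightarrow> grade_involution r = r"
proof -
  note [simp] = linear_add[OF linear_grade_involution] linear_diff[OF linear_grade_involution]
    linear_0[OF linear_grade_involution]
  have "grade_involution (1 + 1) = 1 + 1"
    by (simp only: linear_add[OF linear_grade_involution] grade_involution_gens)
  then show "r \<in> super_relators n \<Longrightarrow> grade_involution r = r"
    by (auto simp: super_relators_def grade_involution_mult grade_involution_gens)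
qed

lemma relator_deriv: "r \<in> super_relators n \<Longrightarrow> grassmann_deriv j r = 0"
proof -
  note [simp] = linear_add[OF linear_grassmann_deriv] linear_diff[OF linear_grassmann_deriv]
    linear_0[OF linear_grassmann_deriv]
  have "grassmann_deriv j (1 + 1) = 0"
    by (simp only: linear_add[OF linear_grassmann_deriv] grassmann_deriv_gens) simp
  then show "r \<in> super_relators n \<Longrightarrow> grassmann_deriv j r = 0"
    by (auto simp: super_relators_def grassmann_deriv_mult grassmann_deriv_gens grade_involution_gens)
qed

lemma grassmann_deriv_word_free_super:
  "(FWord g, c) \<in> super_words n \<Longrightarrow> grassmann_deriv_word j g c \<in> free_super n"
proof (induction g)
  case Nil
  then show ?case using subspace_0[OF subspace_free_super] by simp
next
  case (Cons k g)
  then have "(FWord g, c) \<in> super_words n" "k \<in> {1..2*n}" by (auto simp: super_words_def)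
  moreover from this have "Poly_Mapping.single (FWord g, c) 1 \<in> free_super n"
    by (simp add: free_super_def)
  ultimately show ?case
    using Cons.IH
    unfolding grassmann_deriv_word.simps
    by (intro subspace_diff[OF subspace_free_super] free_super_mult free_super_gens)
       (simp_all add: subspace_0[OF subspace_free_super])
qed

lemma grassmann_deriv_free_super: "a \<in> free_super n \<Longrightarrow> grassmann_deriv j a \<in> free_super n"
  unfolding grassmann_deriv_def
  by (intro subspace_sum[OF subspace_free_super] subspace_scale[OF subspace_free_super]
      grassmann_deriv_word_free_super) (auto simp: free_super_def)

lemma grade_involution_free_super: "a \<in> free_super n \<Longrightarrow> grade_involution a \<in> free_super n"
  unfolding grade_involution_def
  by (intro subspace_sum[OF subspace_free_super] subspace_scale[OF subspace_free_super])
     (auto simp: free_super_def)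

lemma grassmann_deriv_ideal:
  assumes "x \<in> super_ideal n"
  shows "grassmann_deriv j x \<in> super_ideal n"
proof (rule linear_image_span[OF linear_grassmann_deriv subspace_super_ideal _ assms[unfolded super_ideal_def]])
  fix x :: "'a super_poly"
  assume "x \<in> {a * r * b | a r b. a \<in> free_super n \<and> r \<in> super_relators n \<and> b \<in> free_super n}"
  then obtain a r b where x: "x = a * r * b"
    and abr: "a \<in> free_super n" "r \<in> super_relators n" "b \<in> free_super n" by blast
  have "grassmann_deriv j x =
      grassmann_deriv j a * r * b + grade_involution a * r * grassmann_deriv j b"
    by (simp add: x grassmann_deriv_mult grade_involution_mult relator_deriv[OF abr(2)]
        relator_grade[OF abr(2)])
  then show "grassmann_deriv j x \<in> super_ideal n"
    using abr by (auto intro!: subspace_add[OF subspace_super_ideal] super_ideal_gen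
        grassmann_deriv_free_super grade_involution_free_super)
qed

lemma free_superdist_tensor: "a \<in> free_super n \<Longrightarrow> T \<otimes>\<^sub>s a \<in> free_superdist n"
  using keys_tensor[of T a] by (auto simp: free_super_def free_superdist_def)

lemma superdist_null_tensor: "r \<in> super_ideal n \<Longrightarrow> T \<otimes>\<^sub>s r \<in> superdist_null n"
  unfolding superdist_null_def by (intro span_base) blast

lemma superdist_null_subset: "superdist_null n \<subseteq> free_superdist n"
  unfolding superdist_null_def
  using free_super_ideal by (intro span_minimal subspace_free_superdist)
    (auto intro!: free_superdist_tensor)

lemma tensor_op_free_superdist:
  assumes "\<And>a. a \<in> free_super n \<Longrightarrow> H a \<in> free_super n" "u \<in> free_superdist n"
  shows "tensor_op D H u \<in> free_superdist n"
  unfolding tensor_op_def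
  using assms
  by (intro subspace_sum[OF subspace_free_superdist] free_superdist_tensor assms(1))
     (auto simp: free_super_def free_superdist_def)

lemma tensor_op_null:
  assumes "linear D" "linear H" "\<And>a. a \<in> super_ideal n \<Longrightarrow> H a \<in> super_ideal n"
    and "u \<in> superdist_null n"
  shows "tensor_op D H u \<in> superdist_null n"
  by (rule linear_image_span[OF linear_tensor_op[OF assms(1)] subspace_superdist_null _
        assms(4)[unfolded superdist_null_def]])
     (auto simp: tensor_op_tensor[OF assms(1,2)] intro!: superdist_null_tensor assms(3))

lemma linear_mult_left: "linear (\<lambda>a. c * a)" for c :: "'m super_poly"
  by (rule linearI) (simp_all add: algebra_simps)

lemma linear_mult_right: "linear (\<lambda>a. a * c)" for c :: "'m super_poly"
  by (rule linearI) (simp_all add: algebra_simps)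

lemma linear_mult_deriv: "linear (\<lambda>a. c * grassmann_deriv j a)"
  using linear_compose[OF linear_grassmann_deriv linear_mult_left] by (simp add: o_def)

lemma linear_ident': "linear (\<lambda>x. x)"
  by (rule linearI) simp_all

lemma tensor_op_mult_right:
  assumes "a \<in> free_super n"
  shows "u \<in> free_superdist n \<Longrightarrow> tensor_op (\<lambda>T. T) (\<lambda>b. b * a) u \<in> free_superdist n"
    and "u \<in> superdist_null n \<Longrightarrow> tensor_op (\<lambda>T. T) (\<lambda>b. b * a) u \<in> superdist_null n"
  using assms
  by (auto intro!: tensor_op_free_superdist tensor_op_null linear_mult_right linear_ident'
      free_super_mult super_ideal_mult_right)

lemma linear_bosonic_dirac: "linear bosonic_dirac"
  unfolding bosonic_dirac_def[abs_def]
  by (intro linear_compose_sum ballI linear_tensor_op linear_dist_deriv)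

lemma linear_fermionic_dirac: "linear (fermionic_dirac n)"
  unfolding fermionic_dirac_def[abs_def]
  by (intro linear_compose_scale_right linear_compose_sum linear_compose_sub ballI
      linear_tensor_op linear_ident')

lemma linear_free_super_dirac: "linear (free_super_dirac n)"
  unfolding free_super_dirac_def[abs_def]
  by (intro linear_compose_sub linear_bosonic_dirac linear_fermionic_dirac)

lemma bosonic_dirac_closed:
  "u \<in> free_superdist n \<Longrightarrow> bosonic_dirac u \<in> free_superdist n"
  "u \<in> superdist_null n \<Longrightarrow> bosonic_dirac u \<in> superdist_null n"
  unfolding bosonic_dirac_def
  by (auto intro!: subspace_sum[OF subspace_free_superdist] subspace_sum[OF subspace_superdist_null]
      tensor_op_free_superdist tensor_op_null linear_mult_left linear_dist_deriv
      free_super_mult free_super_gens super_ideal_mult_left)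

lemma fermionic_dirac_closed:
  "u \<in> free_superdist n \<Longrightarrow> fermionic_dirac n u \<in> free_superdist n"
  "u \<in> superdist_null n \<Longrightarrow> fermionic_dirac n u \<in> superdist_null n"
  unfolding fermionic_dirac_def
  by (intro subspace_scale[OF subspace_free_superdist] subspace_sum[OF subspace_free_superdist]
        subspace_diff[OF subspace_free_superdist] tensor_op_free_superdist free_super_mult
        free_super_gens grassmann_deriv_free_super, auto)
     (intro subspace_scale[OF subspace_superdist_null] subspace_sum[OF subspace_superdist_null]
        subspace_diff[OF subspace_superdist_null] tensor_op_null linear_mult_deriv linear_ident'
        super_ideal_mult_left free_super_gens grassmann_deriv_ideal, auto)

lemma free_super_dirac_closed:
  "u \<in> free_superdist n \<Longrightarrow> free_super_dirac n u \<in> free_superdist n"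
  "u \<in> superdist_null n \<Longrightarrow> free_super_dirac n u \<in> superdist_null n"
  unfolding free_super_dirac_def
  by (simp_all add: subspace_diff[OF subspace_free_superdist] subspace_diff[OF subspace_superdist_null]
      bosonic_dirac_closed fermionic_dirac_closed)

lemma equiv_superdist_rel: "equiv (free_superdist n :: 'm::finite superdist_poly set) (superdist_rel n)"
proof (rule equivI)
  let ?R = "superdist_rel n :: ('m superdist_poly \<times> 'm superdist_poly) set"
  show "?R \<subseteq> free_superdist n \<times> free_superdist n"
    by (auto simp: superdist_rel_def)
  show "refl_on (free_superdist n) ?R"
    using subspace_0[OF subspace_superdist_null] by (auto simp: refl_on_def superdist_rel_def)
  show "sym ?R"
  proof (rule symI)
    fix u v :: "'m superdist_poly" assume "(u, v) \<in> superdist_rel n"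
    then show "(v, u) \<in> superdist_rel n"
      using subspace_neg[OF subspace_superdist_null, of "u - v" n] by (simp add: superdist_rel_def)
  qed
  show "trans ?R"
  proof (rule transI)
    fix u v w :: "'m superdist_poly"
    assume "(u, v) \<in> superdist_rel n" "(v, w) \<in> superdist_rel n"
    then show "(u, w) \<in> superdist_rel n"
      using subspace_add[OF subspace_superdist_null, of "u - v" n "v - w"]
      by (simp add: superdist_rel_def)
  qed
qed

lemma superdist_class_in: "u \<in> free_superdist n \<Longrightarrow> superdist_class n u \<in> superdist n"
  unfolding superdist_class_def superdist_def by (rule quotientI)

lemma superdist_class_eq_iff:
  assumes "u \<in> free_superdist n" "v \<in> free_superdist n"
  shows "superdist_class n u = superdist_class n v \<longleftrightarrow> u - v \<in> superdist_null n"
  using eq_equiv_class_iff[OF equiv_superdist_rel assms] assms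
  by (simp add: superdist_class_def superdist_rel_def)

lemma super_dirac_class:
  assumes "u \<in> free_superdist n"
  shows "super_dirac n (superdist_class n u) = superdist_class n (free_super_dirac n u)"
proof -
  have "congruent (superdist_rel n) (\<lambda>u. superdist_class n (free_super_dirac n u))"
    by (rule congruentI, subst superdist_class_eq_iff)
       (auto simp: superdist_rel_def free_super_dirac_closed linear_diff[OF linear_free_super_dirac, symmetric])
  from UN_equiv_class[OF equiv_superdist_rel this assms] show ?thesis
    by (simp add: super_dirac_def superdist_class_def)
qed

lemma free_super_fermionic_vector: "fermionic_vector n \<in> free_super n"
  unfolding fermionic_vector_def
  by (auto intro!: subspace_sum[OF subspace_free_super] free_super_mult free_super_gens)

lemma prod_gx_free_super: "set js \<subseteq> {1..2*n} \<Longrightarrow> prod_list (map gx js) \<in> free_super n"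
  by (induction js) (auto intro!: free_super_mult free_super_gens)

lemma super_delta_free_superdist: "super_delta n \<in> free_superdist n"
  unfolding super_delta_def
  by (intro free_superdist_tensor prod_gx_free_super) (auto simp del: upt_Suc)

lemma super_fundamental_free_superdist: "super_fundamental n \<nu> \<in> free_superdist n"
  unfolding super_fundamental_def odd_fundamental_def
  by (intro subspace_diff[OF subspace_free_superdist] subspace_sum[OF subspace_free_superdist]
      subspace_scale[OF subspace_free_superdist] free_superdist_tensor tensor_op_mult_right
      bosonic_dirac_closed free_super_power free_super_fermionic_vector free_super_gens)

end

theory Submission
  imports Defs
begin

text \<open>Write \<open>X\<close> for the fermionic vector variable and \<open>\<partial>\<close> for the bosonic Dirac operator. Then \<open>X\<^sup>2\<close> is an
  even element \<open>y\<close> commuting with the Weyl generators, \<open>\<partial>\<^sup>2\<close> is the Laplacian (mixed partial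
  derivatives of test functions commute), the fermionic Dirac operator \<open>D\<close> anticommutes with \<open>\<partial>\<close>,
  and \<open>D X^(2s) = 2 s X^(2s-1)\<close>, \<open>D X^(2s+1) = 2 (s - n) X^(2s)\<close>. Applied to the two sums of the fundamental
  solution, these rules make everything telescope except the term \<open>\<delta> X^(2n) / n!\<close>, and \<open>X^(2n) = y^n\<close> is
  \<open>n!\<close> times the product of all Grassmann generators, because \<open>y\<close> is a sum of \<open>n\<close> commuting
  elements of square zero.\<close>

section \<open>Symmetry of mixed partial derivatives\<close>

text \<open>The chain rule along a coordinate line; it makes the one-variable mean value theorem
  applicable to \<open>partial\<close>.\<close>

lemma has_real_derivative_along_axis:
  fixes f :: "real ^ 'm::finite \<Rightarrow> real"
  assumes "\<And>x. f differentiable at x"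
  shows "((\<lambda>s. f (p + s *\<^sub>R axis i 1)) has_real_derivative partial i f (p + s *\<^sub>R axis i 1)) (at s)"
proof -
  let ?q = "p + s *\<^sub>R axis i 1"
  have f: "(f has_derivative frechet_derivative f (at ?q)) (at ?q)"
    using assms by (simp add: frechet_derivative_works[symmetric])
  have "((\<lambda>s. p + s *\<^sub>R axis i 1) has_derivative (\<lambda>h. h *\<^sub>R axis i 1)) (at s)"
    by (auto intro!: derivative_eq_intros)
  from has_derivative_compose[OF this f]
  have "((\<lambda>s. f (p + s *\<^sub>R axis i 1)) has_derivative
      (\<lambda>h. frechet_derivative f (at ?q) (h *\<^sub>R axis i 1))) (at s)" .
  then show ?thesis
    unfolding has_field_derivative_def partial_def
    by (rule has_derivative_eq_rhs)
      (simp add: fun_eq_iff mult.commute linear_scale[OF has_derivative_linear[OF f]])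
qed

text \<open>The mean value theorem is applied twice, first in direction \<open>i\<close> and then in
  direction \<open>j\<close>. The left-hand side does not change when \<open>i\<close> and
  \<open>j\<close> are exchanged, which is what makes mixed derivatives comparable.\<close>

lemma second_difference:
  fixes f :: "real ^ 'm::finite \<Rightarrow> real"
  assumes f: "\<And>x. f differentiable at x" "\<And>x. partial i f differentiable at x" and "0 < h"
  obtains s t where "0 < s" "s < h" "0 < t" "t < h"
    "f (p + h *\<^sub>R axis i 1 + h *\<^sub>R axis j 1) - f (p + h *\<^sub>R axis i 1) - f (p + h *\<^sub>R axis j 1) + f p
      = h * h * partial j (partial i f) (p + s *\<^sub>R axis i 1 + t *\<^sub>R axis j 1)"
proof -
  let ?u = "axis i 1 :: real ^ 'm" and ?v = "axis j 1 :: real ^ 'm"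
  \<comment> \<open>\<open>\<phi>\<close> is the increment of \<open>f\<close> in direction
    \<open>j\<close>, so the second difference is \<open>\<phi> h - \<phi> 0\<close>.\<close>
  define \<phi> where "\<phi> s = f (p + h *\<^sub>R ?v + s *\<^sub>R ?u) - f (p + s *\<^sub>R ?u)" for s
  have d: "(\<phi> has_real_derivative
      partial i f (p + h *\<^sub>R ?v + s *\<^sub>R ?u) - partial i f (p + s *\<^sub>R ?u)) (at s)" for s
    unfolding \<phi>_def[abs_def] by (intro DERIV_diff has_real_derivative_along_axis f)
  obtain s where s: "0 < s" "s < h"
    "\<phi> h - \<phi> 0 = h * (partial i f (p + h *\<^sub>R ?v + s *\<^sub>R ?u) - partial i f (p + s *\<^sub>R ?u))"
    using MVT2[OF \<open>0 < h\<close> d] by auto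
  define \<psi> where "\<psi> t = partial i f (p + s *\<^sub>R ?u + t *\<^sub>R ?v)" for t
  have d: "(\<psi> has_real_derivative partial j (partial i f) (p + s *\<^sub>R ?u + t *\<^sub>R ?v)) (at t)" for t
    unfolding \<psi>_def[abs_def] by (intro has_real_derivative_along_axis f)
  obtain t where t: "0 < t" "t < h"
    "\<psi> h - \<psi> 0 = h * partial j (partial i f) (p + s *\<^sub>R ?u + t *\<^sub>R ?v)"
    using MVT2[OF \<open>0 < h\<close> d] by auto
  show thesis
    by (rule that[OF s(1,2) t(1,2)]) (use s(3) t(3) in \<open>simp add: \<phi>_def \<psi>_def add_ac algebra_simps\<close>)
qed

text \<open>Both mixed derivatives, evaluated at points near \<open>p\<close>, equal the same second
  difference divided by \<open>h * h\<close>. They are continuous at \<open>p\<close> because they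
  are themselves differentiable, so their values at \<open>p\<close> are arbitrarily close.\<close>

lemma partial_commute:
  fixes f :: "real ^ 'm::finite \<Rightarrow> real"
  assumes "smooth f"
  shows "partial i (partial j f) = partial j (partial i f)"
proof
  fix p
  let ?P = "\<lambda>(i :: 'm) (j :: 'm) (s :: real) (t :: real). p + s *\<^sub>R axis i 1 + t *\<^sub>R axis j 1 :: real ^ 'm"
  have diff: "foldr partial js f differentiable at x" for js x
    using assms by (simp add: smooth_def)
  note f = diff[of "[]", simplified] diff[of "[k]" for k, simplified]
  have lim: "\<exists>e>0. \<forall>s t. 0 < s \<longrightarrow> s < e \<longrightarrow> 0 < t \<longrightarrow> t < e \<longrightarrow>
      \<bar>partial j (partial i f) (?P i j s t) - partial j (partial i f) p\<bar> < d" if "0 < d" for d :: real and i j :: 'm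
  proof -
    have "isCont (partial j (partial i f)) p"
      using diff[of "[j, i]" p] by (simp add: differentiable_imp_continuous_within)
    then obtain r where r: "0 < r"
      "\<And>x. dist x p < r \<Longrightarrow> dist (partial j (partial i f) x) (partial j (partial i f) p) < d"
      using \<open>0 < d\<close> unfolding continuous_at by (metis LIM_def dist_self)
    have "dist (?P i j s t) p < r" if "0 < s" "s < r / 2" "0 < t" "t < r / 2" for s t
    proof -
      have "norm (s *\<^sub>R axis i 1 + t *\<^sub>R axis j 1 :: real ^ 'm) \<le> s + t"
        using norm_triangle_ineq[of "s *\<^sub>R axis i 1 :: real ^ 'm" "t *\<^sub>R axis j 1"] that by simp
      then show ?thesis using that by (simp add: dist_norm add.assoc)
    qed
    with r show ?thesis by (intro exI[of _ "r / 2"]) (auto simp: dist_real_def)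
  qed
  have "\<bar>partial i (partial j f) p - partial j (partial i f) p\<bar> < d" if "0 < d" for d
  proof -
    obtain a where a: "0 < a" "\<And>s t. 0 < s \<Longrightarrow> s < a \<Longrightarrow> 0 < t \<Longrightarrow> t < a \<Longrightarrow>
        \<bar>partial j (partial i f) (?P i j s t) - partial j (partial i f) p\<bar> < d / 2"
      using lim[of "d / 2" j i] \<open>0 < d\<close> by auto
    obtain b where b: "0 < b" "\<And>s t. 0 < s \<Longrightarrow> s < b \<Longrightarrow> 0 < t \<Longrightarrow> t < b \<Longrightarrow>
        \<bar>partial i (partial j f) (?P j i s t) - partial i (partial j f) p\<bar> < d / 2"
      using lim[of "d / 2" i j] \<open>0 < d\<close> by auto
    define h where "h = min a b"
    have h: "0 < h" "h \<le> a" "h \<le> b" using a(1) b(1) by (auto simp: h_def)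
    obtain s t where st: "0 < s" "s < h" "0 < t" "t < h"
      "f (?P i j h h) - f (p + h *\<^sub>R axis i 1) - f (p + h *\<^sub>R axis j 1) + f p
        = h * h * partial j (partial i f) (?P i j s t)"
      using second_difference[OF f h(1)] .
    obtain s' t' where st': "0 < s'" "s' < h" "0 < t'" "t' < h"
      "f (?P j i h h) - f (p + h *\<^sub>R axis j 1) - f (p + h *\<^sub>R axis i 1) + f p
        = h * h * partial i (partial j f) (?P j i s' t')"
      using second_difference[OF f h(1)] .
    have "h * h * partial j (partial i f) (?P i j s t) = h * h * partial i (partial j f) (?P j i s' t')"
      unfolding st(5)[symmetric] st'(5)[symmetric] by (simp add: add_ac)
    then have "partial j (partial i f) (?P i j s t) = partial i (partial j f) (?P j i s' t')"
      using h(1) by simp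
    moreover have "\<bar>partial j (partial i f) (?P i j s t) - partial j (partial i f) p\<bar> < d / 2"
      using st h by (intro a(2)) auto
    moreover have "\<bar>partial i (partial j f) (?P j i s' t') - partial i (partial j f) p\<bar> < d / 2"
      using st' h by (intro b(2)) auto
    ultimately show ?thesis by linarith
  qed
  \<comment> \<open>With \<open>d\<close> equal to the absolute difference itself, a nonzero
    difference would be smaller than itself.\<close>
  from this[of "\<bar>partial i (partial j f) p - partial j (partial i f) p\<bar>"]
  show "partial i (partial j f) p = partial j (partial i f) p" by fastforce
qed

lemma test_partial_commute: "test_partial i (test_partial j \<phi>) = test_partial j (test_partial i \<phi>)"
  by transfer (simp add: partial_commute)

lemma dist_deriv_commute: "dist_deriv i (dist_deriv j T) = dist_deriv j (dist_deriv i T)"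
  by transfer (simp add: test_partial_commute)

section \<open>Congruence modulo the defining relations\<close>

text \<open>Equality in the quotient algebra, expressed on representatives. Membership in
  \<open>free_super n\<close> is built in because the ideal absorbs factors from
  \<open>free_super n\<close>; congruences can then be multiplied without side conditions.\<close>

definition super_cong :: "'m super_poly \<Rightarrow> nat \<Rightarrow> 'm super_poly \<Rightarrow> bool"
    (\<open>(_ \<approx>\<^bsub>_\<^esub> _)\<close> [51, 0, 51] 50)
  where "a \<approx>\<^bsub>n\<^esub> b \<longleftrightarrow> a \<in> free_super n \<and> b \<in> free_super n \<and> a - b \<in> super_ideal n"

lemmas free_super_closed =
  subspace_0[OF subspace_free_super] subspace_add[OF subspace_free_super]
  subspace_diff[OF subspace_free_super] subspace_neg[OF subspace_free_super]
  subspace_scale[OF subspace_free_super] subspace_sum[OF subspace_free_super]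
  free_super_gens free_super_mult free_super_power free_super_fermionic_vector
  grassmann_deriv_free_super

lemma super_cong_refl: "a \<in> free_super n \<Longrightarrow> a \<approx>\<^bsub>n\<^esub> a"
  by (simp add: super_cong_def subspace_0[OF subspace_super_ideal])

lemma super_cong_sym: "a \<approx>\<^bsub>n\<^esub> b \<Longrightarrow> b \<approx>\<^bsub>n\<^esub> a"
  using subspace_neg[OF subspace_super_ideal, of "a - b" n] by (simp add: super_cong_def)

lemma super_cong_trans [trans]: "a \<approx>\<^bsub>n\<^esub> b \<Longrightarrow> b \<approx>\<^bsub>n\<^esub> c \<Longrightarrow> a \<approx>\<^bsub>n\<^esub> c"
  using subspace_add[OF subspace_super_ideal, of "a - b" n "b - c"] by (simp add: super_cong_def)

lemma super_cong_add: "a \<approx>\<^bsub>n\<^esub> b \<Longrightarrow> c \<approx>\<^bsub>n\<^esub> d \<Longrightarrow> a + c \<approx>\<^bsub>n\<^esub> b + d"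
  using subspace_add[OF subspace_super_ideal, of "a - b" n "c - d"]
  by (simp add: super_cong_def free_super_closed algebra_simps)

lemma super_cong_scaleR: "a \<approx>\<^bsub>n\<^esub> b \<Longrightarrow> r *\<^sub>R a \<approx>\<^bsub>n\<^esub> r *\<^sub>R b"
  using subspace_scale[OF subspace_super_ideal, of "a - b" n r]
  by (simp add: super_cong_def free_super_closed scaleR_diff_right)

lemma super_cong_minus: "a \<approx>\<^bsub>n\<^esub> b \<Longrightarrow> - a \<approx>\<^bsub>n\<^esub> - b"
  using super_cong_scaleR[of a n b "- 1"] by simp

lemma super_cong_diff: "a \<approx>\<^bsub>n\<^esub> b \<Longrightarrow> c \<approx>\<^bsub>n\<^esub> d \<Longrightarrow> a - c \<approx>\<^bsub>n\<^esub> b - d"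
  using super_cong_add[of a n b "- c" "- d"] super_cong_minus by fastforce

lemma super_cong_mult:
  assumes "a \<approx>\<^bsub>n\<^esub> b" "c \<approx>\<^bsub>n\<^esub> d"
  shows "a * c \<approx>\<^bsub>n\<^esub> b * d"
proof -
  have "a * c - b * d = (a - b) * c + b * (c - d)"
    by (simp add: algebra_simps)
  then show ?thesis
    using assms by (simp add: super_cong_def free_super_closed super_ideal_mult_left
        super_ideal_mult_right subspace_add[OF subspace_super_ideal])
qed

lemma super_cong_power: "a \<approx>\<^bsub>n\<^esub> b \<Longrightarrow> a ^ k \<approx>\<^bsub>n\<^esub> b ^ k"
  by (induction k) (auto intro: super_cong_mult super_cong_refl free_super_gens)

lemma super_cong_sum: "(\<And>i. i \<in> A \<Longrightarrow> f i \<approx>\<^bsub>n\<^esub> g i) \<Longrightarrow> sum f A \<approx>\<^bsub>n\<^esub> sum g A"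
  by (induction A rule: infinite_finite_induct)
    (auto intro: super_cong_add super_cong_refl free_super_closed)

lemma super_cong_deriv: "a \<approx>\<^bsub>n\<^esub> b \<Longrightarrow> grassmann_deriv j a \<approx>\<^bsub>n\<^esub> grassmann_deriv j b"
  using grassmann_deriv_ideal[of "a - b" n j]
  by (simp add: super_cong_def free_super_closed linear_diff[OF linear_grassmann_deriv])

lemmas super_cong_intros = super_cong_refl super_cong_add super_cong_diff super_cong_minus
  super_cong_scaleR super_cong_mult super_cong_power super_cong_sum super_cong_deriv

lemma super_cong_diff_0: "a - b \<approx>\<^bsub>n\<^esub> c \<Longrightarrow> b \<in> free_super n \<Longrightarrow> a \<approx>\<^bsub>n\<^esub> c + b"
  using super_cong_add[of "a - b" n c b b] super_cong_refl[of b n] by simp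

lemma super_cong_relator: "r \<in> super_relators n \<Longrightarrow> r \<approx>\<^bsub>n\<^esub> 0"
  using super_ideal_gen[of 1 n r 1] free_super_relators[of n]
  by (auto simp: super_cong_def free_super_closed)

text \<open>Real scalars allow halving. This serves identities that are first obtained in
  symmetrised form, such as the squares of \<open>gx j\<close> and of the fermionic vector.\<close>

lemma super_cong_double:
  assumes "a + a \<approx>\<^bsub>n\<^esub> b + b"
  shows "a \<approx>\<^bsub>n\<^esub> b"
  using super_cong_scaleR[OF assms, of "1/2"] by (simp add: scaleR_add_right[symmetric] scaleR_2[symmetric])

section \<open>The defining relations as congruences\<close>

lemma gx_anticommute:
  assumes "j \<in> {1..2*n}" "k \<in> {1..2*n}"
  shows "gx j * gx k \<approx>\<^bsub>n\<^esub> - (gx k * gx j)"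
proof -
  have "gx j * gx k + gx k * gx j \<in> super_relators n"
    using assms unfolding super_relators_def by blast
  from super_cong_add[OF super_cong_relator[OF this], of "- (gx k * gx j)" "- (gx k * gx j)"]
  show ?thesis using assms by (simp add: super_cong_refl free_super_closed)
qed

lemma gx_square:
  assumes "j \<in> {1..2*n}"
  shows "gx j * gx j \<approx>\<^bsub>n\<^esub> 0"
proof (rule super_cong_double)
  have "gx j * gx j + gx j * gx j \<in> super_relators n"
    using assms unfolding super_relators_def by blast
  from super_cong_relator[OF this] show "gx j * gx j + gx j * gx j \<approx>\<^bsub>n\<^esub> 0 + 0" by simp
qed

lemma ce_anticommute: "(ce i :: 'm super_poly) * ce j + ce j * ce i \<approx>\<^bsub>n\<^esub> (if i = j then - 2 else 0)"
proof -
  have r: "ce i * ce j + ce j * ce i + (if i = j then 2 else 0) \<in> super_relators n"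
    unfolding super_relators_def by blast
  have "(if i = j then 2 else 0) \<in> (free_super n :: 'm super_poly set)"
    using free_super_closed(2)[OF free_super_gens(1) free_super_gens(1), where 'a = 'm, of n]
    by (simp add: free_super_closed)
  from super_cong_diff[OF super_cong_relator[OF r] super_cong_refl[OF this]] show ?thesis
    by (auto split: if_splits)
qed

lemma ce_we_anticommute:
  assumes "k \<in> {1..2*n}"
  shows "we k * ce j \<approx>\<^bsub>n\<^esub> - (ce j * we k)"
proof -
  have "ce j * we k + we k * ce j \<in> super_relators n"
    using assms unfolding super_relators_def by blast
  from super_cong_add[OF super_cong_relator[OF this], of "- (ce j * we k)" "- (ce j * we k)"]
  show ?thesis using assms by (simp add: super_cong_refl free_super_closed)
qed

text \<open>The standard symplectic form, with index \<open>2*j-1\<close> paired with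
  \<open>2*j\<close>. The parity test keeps the adjacent indices \<open>2*j\<close> and
  \<open>2*j+1\<close> unpaired.\<close>

definition weyl_form :: "nat \<Rightarrow> nat \<Rightarrow> real"
  where "weyl_form a b = (if odd a then of_bool (b = a + 1) else - of_bool (a = b + 1))"

lemma even_odd_cases:
  fixes a :: nat
  assumes "a \<in> {1..2*n}"
  obtains (even) j where "a = 2*j" "j \<in> {1..n}" | (odd) j where "a = 2*j-1" "j \<in> {1..n}"
proof (cases "even a")
  case True
  then obtain j where "a = 2*j" by blast
  then show thesis using assms by (intro even[of j]) auto
next
  case False
  then obtain j where "a = 2*j+1" using oddE by blast
  then show thesis using assms by (intro odd[of "j+1"]) auto
qed

text \<open>Of the four parity cases, three are families of relators; the case of even
  \<open>a\<close> and odd \<open>b\<close> is the negative of the mixed family.\<close>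

lemma weyl_commutator:
  assumes "a \<in> {1..2*n}" "b \<in> {1..2*n}"
  shows "we a * we b - we b * we a \<approx>\<^bsub>n\<^esub> weyl_form a b *\<^sub>R 1"
proof -
  have oe: "we (2*j-1) * we (2*k) - we (2*k) * we (2*j-1) \<approx>\<^bsub>n\<^esub> (if j = k then 1 else 0)"
    if "j \<in> {1..n}" "k \<in> {1..n}" for j k
  proof -
    have r: "we (2*j-1) * we (2*k) - we (2*k) * we (2*j-1) - (if j = k then 1 else 0) \<in> super_relators n"
      using that unfolding super_relators_def by blast
    show ?thesis
      using super_cong_diff_0[OF super_cong_relator[OF r]] by (cases "j = k") (simp_all add: free_super_closed)
  qed
  have eo: "we (2*k) * we (2*j-1) - we (2*j-1) * we (2*k) \<approx>\<^bsub>n\<^esub> - (if j = k then 1 else 0)"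
    if "j \<in> {1..n}" "k \<in> {1..n}" for j k
    using super_cong_minus[OF oe[OF that]] by simp
  show ?thesis
    using assms(1)
  proof (cases rule: even_odd_cases)
    case j: (even j)
    show ?thesis using assms(2)
    proof (cases rule: even_odd_cases)
      case k: (even k)
      have "we a * we b - we b * we a \<in> super_relators n"
        unfolding super_relators_def j k using j(2) k(2) by blast
      moreover have "weyl_form a b = 0" using j k by (auto simp: weyl_form_def) presburger
      ultimately show ?thesis using super_cong_relator by fastforce
    next
      case k: (odd k)
      have "weyl_form a b = (if k = j then - 1 else 0)"
        using j k by (auto simp: weyl_form_def)
      with eo[OF k(2) j(2)] j k show ?thesis by (auto split: if_splits)
    qed
  next
    case j: (odd j)
    show ?thesis using assms(2)
    proof (cases rule: even_odd_cases)
      case k: (odd k)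
      have "we a * we b - we b * we a \<in> super_relators n"
        unfolding super_relators_def j k using j(2) k(2) by blast
      moreover have "weyl_form a b = 0" using j k by (auto simp: weyl_form_def) presburger
      ultimately show ?thesis using super_cong_relator by fastforce
    next
      case k: (even k)
      from oe[OF j(2) k(2)] j k show ?thesis by (auto simp: weyl_form_def split: if_splits)
    qed
  qed
qed

text \<open>An exact equality, since Grassmann and Clifford-Weyl letters sit in separate components
  of a word.\<close>

lemma gx_we_commute: "we k * gx j = gx j * we k"
  by (simp add: gx_def we_def mult_single)

section \<open>Powers of the fermionic vector variable\<close>

definition gx_pair :: "nat \<Rightarrow> 'm super_poly"
  where "gx_pair j = gx (2*j-1) * gx (2*j)"

text \<open>For \<open>m = n\<close> this represents the square of the fermionic vector. The bound
  is a separate parameter so that the top power can be computed by induction on the number of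
  pairs.\<close>

definition gx_pair_sum :: "nat \<Rightarrow> 'm super_poly"
  where "gx_pair_sum m = (\<Sum>j=1..m. gx_pair j)"

lemma sum_odd_even:
  "(\<Sum>a=1..2*m. f a) = (\<Sum>j=1..m. f (2*j-1) + f (2*j))"
  for m :: nat and f :: "nat \<Rightarrow> 'a::comm_monoid_add"
  by (induction m) (simp_all add: add.assoc)

lemma even_odd_range:
  fixes j n :: nat
  assumes "j \<in> {1..n}"
  shows "2*j-1 \<in> {1..2*n}" "2*j \<in> {1..2*n}"
  using assms by auto

lemma free_super_gx_pair:
  assumes "j \<in> {1..n}"
  shows "gx_pair j \<in> free_super n"
  unfolding gx_pair_def by (intro free_super_closed even_odd_range assms)

lemma free_super_gx_pair_sum: "m \<le> n \<Longrightarrow> gx_pair_sum m \<in> free_super n"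
  unfolding gx_pair_sum_def by (intro free_super_closed free_super_gx_pair) auto

text \<open>Collecting the Grassmann letters on the left and reordering them costs a sign, which
  turns the anticommutator into a commutator of Weyl generators.\<close>

lemma gx_we_anticommutator:
  assumes "a \<in> {1..2*n}" "b \<in> {1..2*n}"
  shows "gx a * we a * (gx b * we b) + gx b * we b * (gx a * we a)
    \<approx>\<^bsub>n\<^esub> weyl_form a b *\<^sub>R (gx a * gx b)"
proof -
  have swap: "gx a * we a * (gx b * we b) = gx a * gx b * (we a * we b)" for a b
    by (metis gx_we_commute mult.assoc)
  have "gx a * gx b * (we a * we b) + gx b * gx a * (we b * we a)
      \<approx>\<^bsub>n\<^esub> gx a * gx b * (we a * we b) + - (gx a * gx b) * (we b * we a)"
    by (intro super_cong_intros gx_anticommute free_super_closed assms)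
  also have "\<dots> = gx a * gx b * (we a * we b - we b * we a)"
    by (simp add: right_diff_distrib)
  also have "\<dots> \<approx>\<^bsub>n\<^esub> gx a * gx b * (weyl_form a b *\<^sub>R 1)"
    by (intro super_cong_intros weyl_commutator free_super_closed assms)
  finally show ?thesis by (simp add: swap)
qed

text \<open>Each row of the symplectic matrix has exactly one nonzero entry.\<close>

lemma weyl_form_sum:
  fixes f :: "nat \<Rightarrow> 'a::real_vector"
  assumes "j \<in> {1..n}"
  shows "(\<Sum>b=1..2*n. weyl_form (2*j-1) b *\<^sub>R f b) = f (2*j)"
    and "(\<Sum>b=1..2*n. weyl_form (2*j) b *\<^sub>R f b) = - f (2*j-1)"
proof -
  have "(\<Sum>b=1..2*n. weyl_form (2*j-1) b *\<^sub>R f b) = (\<Sum>b=1..2*n. if b = 2*j then f b else 0)"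
    using assms by (intro sum.cong) (auto simp: weyl_form_def)
  then show "(\<Sum>b=1..2*n. weyl_form (2*j-1) b *\<^sub>R f b) = f (2*j)"
    using even_odd_range[OF assms] by (simp only: sum.delta finite_atLeastAtMost if_True)
  have "(\<Sum>b=1..2*n. weyl_form (2*j) b *\<^sub>R f b) = (\<Sum>b=1..2*n. if b = 2*j-1 then - f b else 0)"
    using assms by (intro sum.cong) (auto simp: weyl_form_def)
  then show "(\<Sum>b=1..2*n. weyl_form (2*j) b *\<^sub>R f b) = - f (2*j-1)"
    using even_odd_range[OF assms] by (simp only: sum.delta finite_atLeastAtMost if_True)
qed

text \<open>Symmetrising the double sum writes twice the square as a sum of anticommutators. Only
  the index pairs \<open>2*j-1\<close>, \<open>2*j\<close> survive, and each occurs in both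
  orders.\<close>

lemma fermionic_vector_square: "fermionic_vector n * fermionic_vector n \<approx>\<^bsub>n\<^esub> gx_pair_sum n"
proof (rule super_cong_double)
  let ?t = "\<lambda>a. gx a * we a"
  have "fermionic_vector n * fermionic_vector n + fermionic_vector n * fermionic_vector n
      = (\<Sum>a=1..2*n. \<Sum>b=1..2*n. ?t a * ?t b) + (\<Sum>a=1..2*n. \<Sum>b=1..2*n. ?t b * ?t a)"
    unfolding fermionic_vector_def sum_product
    \<comment> \<open>The fourth double sum is the transposed copy on the right; exchanging its
      summations makes both sides identical.\<close>
    by (subst (4) sum.swap) (rule refl)
  also have "\<dots> = (\<Sum>a=1..2*n. \<Sum>b=1..2*n. ?t a * ?t b + ?t b * ?t a)"
    by (simp add: sum.distrib)
  also have "\<dots> \<approx>\<^bsub>n\<^esub> (\<Sum>a=1..2*n. \<Sum>b=1..2*n. weyl_form a b *\<^sub>R (gx a * gx b))"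
    by (intro super_cong_sum gx_we_anticommutator)
  also have "\<dots> = (\<Sum>j=1..n. gx (2*j-1) * gx (2*j) + - (gx (2*j) * gx (2*j-1)))"
    unfolding sum_odd_even[of "\<lambda>a. \<Sum>b=1..2*n. weyl_form a b *\<^sub>R (gx a * gx b)"]
    by (intro sum.cong refl arg_cong2[where f = "(+)"] weyl_form_sum)
  also have "\<dots> \<approx>\<^bsub>n\<^esub> (\<Sum>j=1..n. gx (2*j-1) * gx (2*j) + - (- (gx (2*j-1) * gx (2*j))))"
    by (intro super_cong_intros gx_anticommute free_super_closed even_odd_range)
  also have "\<dots> = gx_pair_sum n + gx_pair_sum n"
    by (simp add: gx_pair_sum_def gx_pair_def sum.distrib)
  finally show "fermionic_vector n * fermionic_vector n + fermionic_vector n * fermionic_vector n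
      \<approx>\<^bsub>n\<^esub> gx_pair_sum n + gx_pair_sum n" .
qed

lemma fermionic_vector_power_even: "fermionic_vector n ^ (2 * s) \<approx>\<^bsub>n\<^esub> gx_pair_sum n ^ s"
  unfolding power_mult power2_eq_square by (intro super_cong_power fermionic_vector_square)

section \<open>Commuting nilpotent pairs and the top power\<close>

lemma gx_pair_gx_commute:
  assumes "j \<in> {1..n}" "k \<in> {1..2*n}"
  shows "gx_pair j * gx k \<approx>\<^bsub>n\<^esub> gx k * gx_pair j"
proof -
  note r = even_odd_range[OF assms(1)] assms(2)
  have "gx_pair j * gx k = gx (2*j-1) * (gx (2*j) * gx k)"
    by (simp add: gx_pair_def mult.assoc)
  also have "\<dots> \<approx>\<^bsub>n\<^esub> gx (2*j-1) * - (gx k * gx (2*j))"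
    by (intro super_cong_intros gx_anticommute free_super_closed r)
  also have "\<dots> = - (gx (2*j-1) * gx k) * gx (2*j)"
    by (simp add: mult.assoc)
  \<comment> \<open>The second sign change cancels the first: a product of two Grassmann generators
    is even.\<close>
  also have "\<dots> \<approx>\<^bsub>n\<^esub> - (- (gx k * gx (2*j-1))) * gx (2*j)"
    by (intro super_cong_intros gx_anticommute free_super_closed r)
  finally show ?thesis by (simp add: gx_pair_def mult.assoc)
qed

lemma gx_pair_commute:
  assumes "j \<in> {1..n}" "k \<in> {1..n}"
  shows "gx_pair j * gx_pair k \<approx>\<^bsub>n\<^esub> gx_pair k * gx_pair j"
proof -
  note r = even_odd_range[OF assms(2)]
  have "gx_pair j * gx_pair k = gx_pair j * gx (2*k-1) * gx (2*k)"
    by (simp add: gx_pair_def mult.assoc)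
  also have "\<dots> \<approx>\<^bsub>n\<^esub> gx (2*k-1) * gx_pair j * gx (2*k)"
    by (intro super_cong_intros gx_pair_gx_commute free_super_closed r assms)
  also have "\<dots> = gx (2*k-1) * (gx_pair j * gx (2*k))"
    by (simp add: mult.assoc)
  also have "\<dots> \<approx>\<^bsub>n\<^esub> gx (2*k-1) * (gx (2*k) * gx_pair j)"
    by (intro super_cong_intros gx_pair_gx_commute free_super_closed r assms)
  finally show ?thesis by (simp add: gx_pair_def[of k] mult.assoc)
qed

lemma gx_pair_square:
  assumes "j \<in> {1..n}"
  shows "gx_pair j * gx_pair j \<approx>\<^bsub>n\<^esub> 0"
proof -
  note r = even_odd_range[OF assms]
  have "gx_pair j * gx_pair j = gx_pair j * gx (2*j-1) * gx (2*j)"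
    by (simp add: gx_pair_def mult.assoc)
  also have "\<dots> \<approx>\<^bsub>n\<^esub> gx (2*j-1) * gx_pair j * gx (2*j)"
    by (intro super_cong_intros gx_pair_gx_commute free_super_closed r assms)
  also have "\<dots> = (gx (2*j-1) * gx (2*j-1)) * (gx (2*j) * gx (2*j))"
    by (simp add: gx_pair_def mult.assoc)
  also have "\<dots> \<approx>\<^bsub>n\<^esub> 0 * (gx (2*j) * gx (2*j))"
    by (intro super_cong_intros gx_square free_super_closed r)
  finally show ?thesis by simp
qed

text \<open>The binomial formula, cut off after the linear term in \<open>z\<close> because
  \<open>z * z\<close> vanishes.\<close>

lemma power_add_nilpotent:
  assumes "z * y \<approx>\<^bsub>n\<^esub> y * z" "z * z \<approx>\<^bsub>n\<^esub> 0"
    and free: "y \<in> free_super n" "z \<in> free_super n"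
  shows "(y + z) ^ Suc k \<approx>\<^bsub>n\<^esub> y ^ Suc k + real (Suc k) *\<^sub>R (y ^ k * z)"
proof (induction k)
  case 0
  show ?case using free by (simp add: super_cong_refl free_super_closed)
next
  case (Suc k)
  have "(y + z) ^ Suc (Suc k) = (y + z) ^ Suc k * (y + z)"
    by (rule power_Suc2)
  also have "\<dots> \<approx>\<^bsub>n\<^esub> (y ^ Suc k + real (Suc k) *\<^sub>R (y ^ k * z)) * (y + z)"
    by (intro super_cong_mult Suc.IH super_cong_intros free_super_closed free)
  also have "\<dots> = y ^ Suc (Suc k) + y ^ Suc k * z +
      (real (Suc k) *\<^sub>R (y ^ k * (z * y)) + real (Suc k) *\<^sub>R (y ^ k * (z * z)))"
    by (simp add: distrib_left distrib_right mult.assoc power_commutes scaleR_add_right)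
  also have "\<dots> \<approx>\<^bsub>n\<^esub> y ^ Suc (Suc k) + y ^ Suc k * z +
      (real (Suc k) *\<^sub>R (y ^ k * (y * z)) + real (Suc k) *\<^sub>R (y ^ k * 0))"
    by (intro super_cong_intros assms free_super_closed)
  also have "\<dots> = y ^ Suc (Suc k) + real (Suc (Suc k)) *\<^sub>R (y ^ Suc k * z)"
  proof -
    have "y ^ k * (y * z) = y ^ Suc k * z"
      by (metis mult.assoc power_Suc2)
    then show ?thesis by (simp add: scaleR_add_left scaleR_2)
  qed
  finally show ?case .
qed

text \<open>Both claims go through one induction: adding a pair multiplies the old top power by that
  pair and by \<open>Suc m\<close>, and the vanishing of the old next power removes the remaining
  summand.\<close>

lemma gx_pair_sum_powers:
  "m \<le> n \<Longrightarrow> (gx_pair_sum m :: 'm super_poly) ^ m \<approx>\<^bsub>n\<^esub> fact m *\<^sub>R prod_list (map gx [1..<2*m+1]) \<and>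
    (gx_pair_sum m :: 'm super_poly) ^ Suc m \<approx>\<^bsub>n\<^esub> 0"
proof (induction m)
  case 0
  show ?case by (simp add: gx_pair_sum_def super_cong_refl free_super_closed)
next
  case (Suc m)
  let ?y = "gx_pair_sum m :: 'm super_poly" and ?z = "gx_pair (Suc m) :: 'm super_poly"
  let ?g = "prod_list (map gx [1..<2*m+1]) :: 'm super_poly"
  from Suc have IH: "?y ^ m \<approx>\<^bsub>n\<^esub> fact m *\<^sub>R ?g" "?y ^ Suc m \<approx>\<^bsub>n\<^esub> 0" by auto
  have m: "Suc m \<in> {1..n}" using Suc.prems by auto
  have free: "?y \<in> free_super n" "?z \<in> free_super n"
    using Suc.prems m by (auto intro: free_super_gx_pair_sum free_super_gx_pair)
  have sum: "(gx_pair_sum (Suc m) :: 'm super_poly) = ?y + ?z" by (simp add: gx_pair_sum_def)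
  have "?z * ?y \<approx>\<^bsub>n\<^esub> ?y * ?z"
    unfolding gx_pair_sum_def sum_distrib_left sum_distrib_right
    using m by (intro super_cong_sum gx_pair_commute) auto
  note power = power_add_nilpotent[OF this gx_pair_square[OF m] free]
  have next_zero: "?y ^ Suc (Suc m) \<approx>\<^bsub>n\<^esub> 0"
    using super_cong_mult[OF super_cong_refl[OF free(1)] IH(2)] by simp
  have "(gx_pair_sum (Suc m) :: 'm super_poly) ^ Suc m \<approx>\<^bsub>n\<^esub> ?y ^ Suc m + real (Suc m) *\<^sub>R (?y ^ m * ?z)"
    unfolding sum by (rule power)
  also have "\<dots> \<approx>\<^bsub>n\<^esub> 0 + real (Suc m) *\<^sub>R ((fact m *\<^sub>R ?g) * ?z)"
    by (intro super_cong_add super_cong_scaleR super_cong_mult IH super_cong_refl free)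
  also have "\<dots> = fact (Suc m) *\<^sub>R prod_list (map gx [1..<2*Suc m+1])"
    by (simp add: gx_pair_def mult.assoc)
  finally have 1: "(gx_pair_sum (Suc m) :: 'm super_poly) ^ Suc m \<approx>\<^bsub>n\<^esub> \<dots>" .
  have "(gx_pair_sum (Suc m) :: 'm super_poly) ^ Suc (Suc m)
      \<approx>\<^bsub>n\<^esub> ?y ^ Suc (Suc m) + real (Suc (Suc m)) *\<^sub>R (?y ^ Suc m * ?z)"
    unfolding sum by (rule power)
  also have "\<dots> \<approx>\<^bsub>n\<^esub> 0 + real (Suc (Suc m)) *\<^sub>R (0 * ?z)"
    by (intro super_cong_add super_cong_scaleR super_cong_mult IH next_zero super_cong_refl free)
  finally have "(gx_pair_sum (Suc m) :: 'm super_poly) ^ Suc (Suc m) \<approx>\<^bsub>n\<^esub> 0" by simp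
  with 1 show ?case by blast
qed

lemma fermionic_vector_top_power:
  "fermionic_vector n ^ (2*n) \<approx>\<^bsub>n\<^esub> fact n *\<^sub>R prod_list (map gx [1..<2*n+1])"
  using fermionic_vector_power_even[of n n] gx_pair_sum_powers[of n n] super_cong_trans by blast

section \<open>The fermionic Dirac operator\<close>

text \<open>Half of the fermionic Dirac operator, on the algebra factor alone;
  \<open>fermionic_dirac_tensor\<close> restores the factor 2.\<close>

definition fermionic_diff :: "nat \<Rightarrow> 'm super_poly \<Rightarrow> 'm super_poly"
  where "fermionic_diff n a =
    (\<Sum>j=1..n. we (2*j) * grassmann_deriv (2*j-1) a - we (2*j-1) * grassmann_deriv (2*j) a)"

lemma super_cong_fermionic_diff: "a \<approx>\<^bsub>n\<^esub> b \<Longrightarrow> fermionic_diff n a \<approx>\<^bsub>n\<^esub> fermionic_diff n b"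
  unfolding fermionic_diff_def by (intro super_cong_intros free_super_closed even_odd_range)

lemma fermionic_diff_one: "fermionic_diff n 1 = 0"
  by (simp add: fermionic_diff_def grassmann_deriv_gens)

text \<open>For an even \<open>a\<close> the graded Leibniz rule has no sign, and commutation with
  the Weyl generators lets \<open>a\<close> be pulled out on the left.\<close>

lemma fermionic_diff_mult:
  assumes "grade_involution a = a" "\<And>k. we k * a = a * we k"
  shows "fermionic_diff n (a * b) = fermionic_diff n a * b + a * fermionic_diff n b"
proof -
  have "we k * grassmann_deriv j (a * b) = we k * grassmann_deriv j a * b + a * (we k * grassmann_deriv j b)"
    for j k
    by (simp add: grassmann_deriv_mult assms(1) distrib_left mult.assoc[symmetric] assms(2))
  then show ?thesis
    unfolding fermionic_diff_def sum_distrib_left sum_distrib_right sum.distrib[symmetric]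
    by (intro sum.cong) (simp_all add: left_diff_distrib right_diff_distrib)
qed

text \<open>Grassmann derivatives pass over \<open>ce i\<close> without a sign; the sign comes from
  the Weyl generators, which anticommute with it.\<close>

lemma fermionic_diff_ce:
  assumes "a \<in> free_super n"
  shows "fermionic_diff n (ce i * a) \<approx>\<^bsub>n\<^esub> - (ce i * fermionic_diff n a)"
proof -
  have "we k * grassmann_deriv j (ce i * a) \<approx>\<^bsub>n\<^esub> - (ce i * (we k * grassmann_deriv j a))"
    if "k \<in> {1..2*n}" for j k
  proof -
    have "we k * grassmann_deriv j (ce i * a) = we k * ce i * grassmann_deriv j a"
      by (simp add: grassmann_deriv_mult grassmann_deriv_gens grade_involution_gens mult.assoc)
    also have "\<dots> \<approx>\<^bsub>n\<^esub> - (ce i * we k) * grassmann_deriv j a"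
      by (intro super_cong_intros ce_we_anticommute free_super_closed that assms)
    finally show ?thesis by (simp add: mult.assoc)
  qed
  then have "fermionic_diff n (ce i * a) \<approx>\<^bsub>n\<^esub>
      (\<Sum>j=1..n. - (ce i * (we (2*j) * grassmann_deriv (2*j-1) a))
        - - (ce i * (we (2*j-1) * grassmann_deriv (2*j) a)))"
    unfolding fermionic_diff_def by (intro super_cong_sum super_cong_diff) (simp_all only: even_odd_range)
  also have "\<dots> = - (ce i * fermionic_diff n a)"
    unfolding fermionic_diff_def sum_distrib_left sum_negf[symmetric]
    by (intro sum.cong refl) (simp add: right_diff_distrib)
  finally show ?thesis .
qed

section \<open>Derivatives of the powers of the fermionic vector\<close>

lemma grassmann_deriv_gx_pair:
  "grassmann_deriv k (gx_pair j) =
    (if k = 2*j-1 then gx (2*j) else 0) - (if k = 2*j then gx (2*j-1) else 0)"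
  by (simp add: gx_pair_def grassmann_deriv_mult grassmann_deriv_gens grade_involution_gens)

lemma grassmann_deriv_gx_pair_sum:
  assumes "i \<in> {1..n}"
  shows "grassmann_deriv (2*i-1) (gx_pair_sum n) = gx (2*i)"
    and "grassmann_deriv (2*i) (gx_pair_sum n) = - gx (2*i-1)"
proof -
  have i: "2*i-1 = 2*j-1 \<longleftrightarrow> j = i" "2*i-1 \<noteq> 2*j" "2*i \<noteq> 2*j-1" "2*i = 2*j \<longleftrightarrow> j = i"
    if "j \<in> {1..n}" for j
    using that assms by (auto, presburger+)
  show "grassmann_deriv (2*i-1) (gx_pair_sum n) = gx (2*i)"
  proof -
    have "grassmann_deriv (2*i-1) (gx_pair_sum n) = (\<Sum>j=1..n. if j = i then gx (2*j) else 0)"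
      unfolding gx_pair_sum_def linear_sum[OF linear_grassmann_deriv] grassmann_deriv_gx_pair
      by (intro sum.cong refl) (simp only: i if_False, simp)
    then show ?thesis using assms by simp
  qed
  show "grassmann_deriv (2*i) (gx_pair_sum n) = - gx (2*i-1)"
  proof -
    have "grassmann_deriv (2*i) (gx_pair_sum n) = (\<Sum>j=1..n. if j = i then - gx (2*j-1) else 0)"
      unfolding gx_pair_sum_def linear_sum[OF linear_grassmann_deriv] grassmann_deriv_gx_pair
      by (intro sum.cong refl) (simp only: i if_False, simp)
    then show ?thesis using assms by simp
  qed
qed

text \<open>Differentiating a pair leaves its partner variable, and the sign from passing over the
  first variable cancels the minus sign in the operator.\<close>

lemma fermionic_diff_gx_pair_sum: "fermionic_diff n (gx_pair_sum n) = fermionic_vector n"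
proof -
  have "fermionic_diff n (gx_pair_sum n) = (\<Sum>j=1..n. we (2*j) * gx (2*j) - we (2*j-1) * - gx (2*j-1))"
    unfolding fermionic_diff_def by (intro sum.cong) (auto simp only: grassmann_deriv_gx_pair_sum)
  also have "\<dots> = fermionic_vector n"
    unfolding fermionic_vector_def sum_odd_even
    by (intro sum.cong) (simp_all add: gx_we_commute)
  finally show ?thesis .
qed

lemma grade_involution_gx_pair_sum: "grade_involution (gx_pair_sum n) = gx_pair_sum n"
  by (simp add: gx_pair_sum_def gx_pair_def linear_sum[OF linear_grade_involution]
      grade_involution_mult grade_involution_gens)

lemma we_gx_pair_commute: "we k * gx_pair j = gx_pair j * we k"
  unfolding gx_pair_def
  by (simp only: mult.assoc[symmetric] gx_we_commute) (simp only: mult.assoc gx_we_commute)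

lemma we_gx_pair_sum_commute: "we k * gx_pair_sum n = gx_pair_sum n * we k"
  by (simp add: gx_pair_sum_def sum_distrib_left sum_distrib_right we_gx_pair_commute)

lemma grade_involution_gx_pair_sum_power: "grade_involution (gx_pair_sum n ^ s) = gx_pair_sum n ^ s"
  by (induction s) (simp_all add: grade_involution_gens grade_involution_mult grade_involution_gx_pair_sum)

lemma we_gx_pair_sum_power_commute: "we k * gx_pair_sum n ^ s = gx_pair_sum n ^ s * we k"
  by (metis power_commuting_commutes we_gx_pair_sum_commute)

text \<open>Since the derivative for index \<open>k\<close> of the vector is \<open>we k\<close>,
  the result is a sum of \<open>n\<close> Weyl commutators, each congruent to -1.\<close>

lemma fermionic_diff_fermionic_vector: "fermionic_diff n (fermionic_vector n) \<approx>\<^bsub>n\<^esub> - real n *\<^sub>R 1"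
proof -
  have deriv: "grassmann_deriv k (fermionic_vector n) = we k" if "k \<in> {1..2*n}" for k
  proof -
    have "grassmann_deriv k (fermionic_vector n) = (\<Sum>a=1..2*n. if a = k then we a else 0)"
      unfolding fermionic_vector_def linear_sum[OF linear_grassmann_deriv]
      by (rule sum.cong) (auto simp: grassmann_deriv_mult grassmann_deriv_gens)
    then show ?thesis using that by simp
  qed
  have "fermionic_diff n (fermionic_vector n) = (\<Sum>j=1..n. we (2*j) * we (2*j-1) - we (2*j-1) * we (2*j))"
    unfolding fermionic_diff_def by (intro sum.cong) (auto simp only: deriv even_odd_range)
  also have "\<dots> \<approx>\<^bsub>n\<^esub> (\<Sum>j=1..n. weyl_form (2*j) (2*j-1) *\<^sub>R 1)"
    by (intro super_cong_sum weyl_commutator even_odd_range)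
  also have "\<dots> = (\<Sum>j=1..n. - 1)"
    by (intro sum.cong) (auto simp: weyl_form_def)
  also have "\<dots> = - real n *\<^sub>R 1"
    by (simp add: scaleR_conv_of_real)
  finally show ?thesis .
qed

lemma fermionic_vector_times_power:
  "gx_pair_sum n ^ s * fermionic_vector n \<approx>\<^bsub>n\<^esub> fermionic_vector n ^ Suc (2 * s)"
  "fermionic_vector n * gx_pair_sum n ^ s \<approx>\<^bsub>n\<^esub> fermionic_vector n ^ Suc (2 * s)"
proof -
  note p = super_cong_sym[OF fermionic_vector_power_even[of n s]]
  show "gx_pair_sum n ^ s * fermionic_vector n \<approx>\<^bsub>n\<^esub> fermionic_vector n ^ Suc (2 * s)"
    unfolding power_Suc2 by (intro super_cong_mult p super_cong_refl free_super_closed)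
  show "fermionic_vector n * gx_pair_sum n ^ s \<approx>\<^bsub>n\<^esub> fermionic_vector n ^ Suc (2 * s)"
    unfolding power_Suc by (intro super_cong_mult p super_cong_refl free_super_closed)
qed

text \<open>Induction with the Leibniz rule for the even element \<open>gx_pair_sum n\<close>. At
  \<open>s = 0\<close> the exponent \<open>2 * s - 1\<close> is truncated to 0, but its coefficient
  is 0.\<close>

lemma fermionic_diff_gx_pair_sum_power:
  "fermionic_diff n ((gx_pair_sum n :: 'm super_poly) ^ s) \<approx>\<^bsub>n\<^esub> real s *\<^sub>R fermionic_vector n ^ (2 * s - 1)"
proof (induction s)
  case 0
  show ?case by (simp add: fermionic_diff_one super_cong_refl free_super_closed)
next
  case (Suc s)
  let ?X = "fermionic_vector n :: 'm super_poly" and ?y = "gx_pair_sum n :: 'm super_poly"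
  have "fermionic_diff n (?y ^ Suc s) = ?X * ?y ^ s + ?y * fermionic_diff n (?y ^ s)"
    by (simp add: fermionic_diff_mult grade_involution_gx_pair_sum we_gx_pair_sum_commute
        fermionic_diff_gx_pair_sum)
  also have "\<dots> \<approx>\<^bsub>n\<^esub> ?X ^ Suc (2 * s) + (?X * ?X) * (real s *\<^sub>R ?X ^ (2 * s - 1))"
    by (intro super_cong_add super_cong_mult fermionic_vector_times_power Suc.IH
        super_cong_sym[OF fermionic_vector_square])
  also have "\<dots> = real (Suc s) *\<^sub>R ?X ^ (2 * Suc s - 1)"
    by (cases s) (simp_all add: scaleR_add_left distrib_left mult.assoc scaleR_2)
  finally show ?case .
qed

lemma fermionic_diff_even_power:
  "fermionic_diff n (fermionic_vector n ^ (2 * s)) \<approx>\<^bsub>n\<^esub> real s *\<^sub>R fermionic_vector n ^ (2 * s - 1)"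
  by (rule super_cong_trans[OF super_cong_fermionic_diff[OF fermionic_vector_power_even]
        fermionic_diff_gx_pair_sum_power])

text \<open>Splitting off one factor of the vector, the even part contributes \<open>s\<close> by
  the previous rule and the single vector contributes \<open>- n\<close>.\<close>

lemma fermionic_diff_odd_power:
  "fermionic_diff n ((fermionic_vector n :: 'm super_poly) ^ Suc (2 * s))
    \<approx>\<^bsub>n\<^esub> (real s - real n) *\<^sub>R fermionic_vector n ^ (2 * s)"
proof -
  let ?X = "fermionic_vector n :: 'm super_poly" and ?y = "gx_pair_sum n :: 'm super_poly"
  have "fermionic_diff n (?X ^ Suc (2 * s)) \<approx>\<^bsub>n\<^esub> fermionic_diff n (?y ^ s * ?X)"
    by (intro super_cong_fermionic_diff super_cong_sym[OF fermionic_vector_times_power(1)])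
  also have "\<dots> = fermionic_diff n (?y ^ s) * ?X + ?y ^ s * fermionic_diff n ?X"
    by (rule fermionic_diff_mult[OF grade_involution_gx_pair_sum_power we_gx_pair_sum_power_commute])
  also have "\<dots> \<approx>\<^bsub>n\<^esub> (real s *\<^sub>R ?X ^ (2 * s - 1)) * ?X + ?X ^ (2 * s) * (- real n *\<^sub>R 1)"
    by (intro super_cong_add super_cong_mult fermionic_diff_gx_pair_sum_power
        fermionic_diff_fermionic_vector super_cong_sym[OF fermionic_vector_power_even]
        super_cong_refl free_super_closed)
  also have "\<dots> = (real s - real n) *\<^sub>R ?X ^ (2 * s)"
    by (cases s) (simp_all add: scaleR_diff_left power_commutes mult.assoc)
  finally show ?thesis .
qed

section \<open>The super Dirac operator\<close>

text \<open>Carrier membership is left to \<open>superdist_class_eqI\<close>, where congruences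
  become equalities of classes.\<close>

definition superdist_cong :: "'m::finite superdist_poly \<Rightarrow> nat \<Rightarrow> 'm superdist_poly \<Rightarrow> bool"
    (\<open>(_ \<simeq>\<^bsub>_\<^esub> _)\<close> [51, 0, 51] 50)
  where "u \<simeq>\<^bsub>n\<^esub> v \<longleftrightarrow> u - v \<in> superdist_null n"

lemma superdist_cong_refl: "u \<simeq>\<^bsub>n\<^esub> u"
  by (simp add: superdist_cong_def subspace_0[OF subspace_superdist_null])

lemma superdist_cong_trans [trans]: "u \<simeq>\<^bsub>n\<^esub> v \<Longrightarrow> v \<simeq>\<^bsub>n\<^esub> w \<Longrightarrow> u \<simeq>\<^bsub>n\<^esub> w"
  using subspace_add[OF subspace_superdist_null, of "u - v" n "v - w"] by (simp add: superdist_cong_def)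

lemma superdist_cong_add: "u \<simeq>\<^bsub>n\<^esub> v \<Longrightarrow> w \<simeq>\<^bsub>n\<^esub> z \<Longrightarrow> u + w \<simeq>\<^bsub>n\<^esub> v + z"
  using subspace_add[OF subspace_superdist_null, of "u - v" n "w - z"]
  by (simp add: superdist_cong_def algebra_simps)

lemma superdist_cong_diff: "u \<simeq>\<^bsub>n\<^esub> v \<Longrightarrow> w \<simeq>\<^bsub>n\<^esub> z \<Longrightarrow> u - w \<simeq>\<^bsub>n\<^esub> v - z"
  using subspace_diff[OF subspace_superdist_null, of "u - v" n "w - z"]
  by (simp add: superdist_cong_def algebra_simps)

lemma superdist_cong_scaleR: "u \<simeq>\<^bsub>n\<^esub> v \<Longrightarrow> r *\<^sub>R u \<simeq>\<^bsub>n\<^esub> r *\<^sub>R v"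
  using subspace_scale[OF subspace_superdist_null, of "u - v" n r]
  by (simp add: superdist_cong_def scaleR_diff_right)

lemma superdist_cong_sum: "(\<And>i. i \<in> A \<Longrightarrow> f i \<simeq>\<^bsub>n\<^esub> g i) \<Longrightarrow> sum f A \<simeq>\<^bsub>n\<^esub> sum g A"
  by (induction A rule: infinite_finite_induct) (auto intro: superdist_cong_add superdist_cong_refl)

lemma superdist_cong_tensor: "a \<approx>\<^bsub>n\<^esub> b \<Longrightarrow> T \<otimes>\<^sub>s a \<simeq>\<^bsub>n\<^esub> T \<otimes>\<^sub>s b"
  using superdist_null_tensor[of "a - b" n T]
  by (simp add: superdist_cong_def super_cong_def linear_diff[OF linear_tensor])

lemma superdist_cong_bosonic_dirac: "u \<simeq>\<^bsub>n\<^esub> v \<Longrightarrow> bosonic_dirac u \<simeq>\<^bsub>n\<^esub> bosonic_dirac v"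
  unfolding superdist_cong_def linear_diff[OF linear_bosonic_dirac, symmetric]
  by (rule bosonic_dirac_closed)

lemma superdist_class_eqI:
  assumes "u \<in> free_superdist n" "v \<in> free_superdist n" "u \<simeq>\<^bsub>n\<^esub> v"
  shows "superdist_class n u = superdist_class n v"
  using assms by (simp add: superdist_class_eq_iff superdist_cong_def)

section \<open>The two Dirac operators on elementary tensors\<close>

lemma bosonic_dirac_tensor: "bosonic_dirac (T \<otimes>\<^sub>s a) = (\<Sum>j\<in>UNIV. dist_deriv j T \<otimes>\<^sub>s (ce j * a))"
  by (simp add: bosonic_dirac_def tensor_op_tensor linear_dist_deriv linear_mult_left)

lemma fermionic_dirac_tensor: "fermionic_dirac n (T \<otimes>\<^sub>s a) = 2 *\<^sub>R (T \<otimes>\<^sub>s fermionic_diff n a)"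
  by (simp add: fermionic_dirac_def fermionic_diff_def tensor_op_tensor linear_ident'
      linear_mult_deriv linear_sum[OF linear_tensor] linear_diff[OF linear_tensor])

text \<open>As the derivatives commute, only the anticommutators of the \<open>ce i\<close> matter.
  They contribute -2 on the diagonal of the doubled sum, matching the sign in
  \<open>laplace_b\<close>.\<close>

lemma bosonic_dirac_squared:
  assumes "a \<in> free_super n"
  shows "bosonic_dirac (bosonic_dirac (T \<otimes>\<^sub>s a)) \<simeq>\<^bsub>n\<^esub> laplace_b T \<otimes>\<^sub>s a"
proof -
  let ?D = "\<lambda>i j. dist_deriv i (dist_deriv j T)"
  have sq: "bosonic_dirac (bosonic_dirac (T \<otimes>\<^sub>s a)) = (\<Sum>j\<in>UNIV. \<Sum>i\<in>UNIV. ?D i j \<otimes>\<^sub>s (ce i * ce j * a))"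
    by (simp add: bosonic_dirac_tensor linear_sum[OF linear_bosonic_dirac] mult.assoc)
  have "bosonic_dirac (bosonic_dirac (T \<otimes>\<^sub>s a)) + bosonic_dirac (bosonic_dirac (T \<otimes>\<^sub>s a))
      = (\<Sum>j\<in>UNIV. \<Sum>i\<in>UNIV. ?D i j \<otimes>\<^sub>s (ce i * ce j * a)) +
        (\<Sum>j\<in>UNIV. \<Sum>i\<in>UNIV. ?D i j \<otimes>\<^sub>s (ce j * ce i * a))"
    \<comment> \<open>Exchanging the summations in the transposed copy and commuting the two
      derivatives returns the first copy.\<close>
    unfolding sq by (subst (4) sum.swap) (simp only: dist_deriv_commute)
  also have "\<dots> = (\<Sum>j\<in>UNIV. \<Sum>i\<in>UNIV. ?D i j \<otimes>\<^sub>s ((ce i * ce j + ce j * ce i) * a))"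
    by (simp add: sum.distrib[symmetric] linear_add[OF linear_tensor, symmetric] distrib_right)
  also have "\<dots> \<simeq>\<^bsub>n\<^esub> (\<Sum>j\<in>UNIV. \<Sum>i\<in>UNIV. ?D i j \<otimes>\<^sub>s ((if i = j then - 2 else 0) * a))"
    by (intro superdist_cong_sum superdist_cong_tensor super_cong_mult ce_anticommute super_cong_refl assms)
  also have "\<dots> = (\<Sum>j\<in>UNIV. \<Sum>i\<in>UNIV. if i = j then ?D j j \<otimes>\<^sub>s (- 2 * a) else 0)"
    by (intro sum.cong) (auto simp: linear_0[OF linear_tensor])
  also have "\<dots> = (\<Sum>j\<in>UNIV. ?D j j \<otimes>\<^sub>s (- 2 * a))"
    by simp
  also have "- 2 * a = (- 2) *\<^sub>R a"
    by (simp add: mult_2 scaleR_2)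
  also have "(\<Sum>j\<in>UNIV. ?D j j \<otimes>\<^sub>s ((- 2) *\<^sub>R a)) = 2 *\<^sub>R (laplace_b T \<otimes>\<^sub>s a)"
    by (simp add: laplace_b_def linear_sum[OF linear_tensor_left] linear_neg[OF linear_tensor_left]
        linear_scale[OF linear_tensor] linear_neg[OF linear_tensor] sum_negf scaleR_sum_right)
  finally show ?thesis
    using superdist_cong_scaleR[of _ n _ "1/2"] by (fastforce simp: scaleR_2[symmetric])
qed

lemma fermionic_bosonic_anticommute:
  assumes "a \<in> free_super n"
  shows "fermionic_dirac n (bosonic_dirac (T \<otimes>\<^sub>s a)) \<simeq>\<^bsub>n\<^esub> - bosonic_dirac (fermionic_dirac n (T \<otimes>\<^sub>s a))"
proof -
  have "fermionic_dirac n (bosonic_dirac (T \<otimes>\<^sub>s a))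
      = 2 *\<^sub>R (\<Sum>j\<in>UNIV. dist_deriv j T \<otimes>\<^sub>s fermionic_diff n (ce j * a))"
    by (simp add: bosonic_dirac_tensor linear_sum[OF linear_fermionic_dirac] fermionic_dirac_tensor
        scaleR_sum_right)
  also have "\<dots> \<simeq>\<^bsub>n\<^esub> 2 *\<^sub>R (\<Sum>j\<in>UNIV. dist_deriv j T \<otimes>\<^sub>s - (ce j * fermionic_diff n a))"
    by (intro superdist_cong_scaleR superdist_cong_sum superdist_cong_tensor fermionic_diff_ce assms)
  also have "\<dots> = - bosonic_dirac (fermionic_dirac n (T \<otimes>\<^sub>s a))"
    by (simp add: fermionic_dirac_tensor linear_scale[OF linear_bosonic_dirac] bosonic_dirac_tensor
        linear_neg[OF linear_tensor] sum_negf)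
  finally show ?thesis .
qed

lemma super_dirac_odd_power:
  "free_super_dirac n (T \<otimes>\<^sub>s fermionic_vector n ^ Suc (2 * s)) \<simeq>\<^bsub>n\<^esub>
    (2 * (real s - real n)) *\<^sub>R (T \<otimes>\<^sub>s fermionic_vector n ^ (2 * s)) -
    bosonic_dirac (T \<otimes>\<^sub>s fermionic_vector n ^ Suc (2 * s))"
proof -
  let ?X = "fermionic_vector n"
  have "free_super_dirac n (T \<otimes>\<^sub>s ?X ^ Suc (2 * s)) =
      2 *\<^sub>R (T \<otimes>\<^sub>s fermionic_diff n (?X ^ Suc (2 * s))) - bosonic_dirac (T \<otimes>\<^sub>s ?X ^ Suc (2 * s))"
    unfolding free_super_dirac_def fermionic_dirac_tensor ..
  also have "\<dots> \<simeq>\<^bsub>n\<^esub> 2 *\<^sub>R (T \<otimes>\<^sub>s ((real s - real n) *\<^sub>R ?X ^ (2 * s)))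
      - bosonic_dirac (T \<otimes>\<^sub>s ?X ^ Suc (2 * s))"
    by (intro superdist_cong_diff superdist_cong_scaleR superdist_cong_tensor
        fermionic_diff_odd_power superdist_cong_refl)
  finally show ?thesis by (simp only: linear_scale[OF linear_tensor] scaleR_scaleR)
qed

text \<open>The first minus sign comes from moving the fermionic operator past the bosonic one, the
  second from the definition of the super Dirac operator.\<close>

lemma super_dirac_bosonic_even_power:
  "free_super_dirac n (bosonic_dirac (T \<otimes>\<^sub>s fermionic_vector n ^ (2 * s))) \<simeq>\<^bsub>n\<^esub>
    - ((2 * real s) *\<^sub>R bosonic_dirac (T \<otimes>\<^sub>s fermionic_vector n ^ (2 * s - 1))) -
    laplace_b T \<otimes>\<^sub>s fermionic_vector n ^ (2 * s)"
proof -
  let ?X = "fermionic_vector n :: 'a super_poly"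
  have X: "?X ^ k \<in> free_super n" for k by (intro free_super_closed)
  have "bosonic_dirac (fermionic_dirac n (T \<otimes>\<^sub>s ?X ^ (2 * s)))
      = 2 *\<^sub>R bosonic_dirac (T \<otimes>\<^sub>s fermionic_diff n (?X ^ (2 * s)))"
    by (simp only: fermionic_dirac_tensor linear_scale[OF linear_bosonic_dirac])
  also have "\<dots> \<simeq>\<^bsub>n\<^esub> 2 *\<^sub>R bosonic_dirac (T \<otimes>\<^sub>s (real s *\<^sub>R ?X ^ (2 * s - 1)))"
    by (intro superdist_cong_scaleR superdist_cong_bosonic_dirac superdist_cong_tensor
        fermionic_diff_even_power)
  also have "\<dots> = (2 * real s) *\<^sub>R bosonic_dirac (T \<otimes>\<^sub>s ?X ^ (2 * s - 1))"
    by (simp only: linear_scale[OF linear_bosonic_dirac] linear_scale[OF linear_tensor] scaleR_scaleR)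
  finally have "fermionic_dirac n (bosonic_dirac (T \<otimes>\<^sub>s ?X ^ (2 * s))) \<simeq>\<^bsub>n\<^esub>
      - ((2 * real s) *\<^sub>R bosonic_dirac (T \<otimes>\<^sub>s ?X ^ (2 * s - 1)))"
    using superdist_cong_trans[OF fermionic_bosonic_anticommute[OF X]]
      superdist_cong_diff[OF superdist_cong_refl[of 0]] by fastforce
  then show ?thesis
    unfolding free_super_dirac_def by (intro superdist_cong_diff bosonic_dirac_squared X)
qed

text \<open>Right multiplication by \<open>b\<close> commutes with left multiplication by the
  \<open>ce j\<close>, so the odd-index terms are bosonic Dirac images of elementary
  tensors.\<close>

lemma odd_fundamental_mult:
  "tensor_op (\<lambda>T. T) (\<lambda>a. a * b) (odd_fundamental \<nu> k) = bosonic_dirac (\<nu> (2*k+2) \<otimes>\<^sub>s b)"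
  by (simp add: odd_fundamental_def bosonic_dirac_tensor linear_sum[OF linear_tensor_op[OF linear_ident']]
      tensor_op_tensor linear_ident' linear_mult_right)

section \<open>Telescoping of the two sums\<close>

theorem theorem3:
  fixes \<nu> :: "nat \<Rightarrow> 'm::finite distribution" and n :: nat
  assumes "\<And>l j. 1 \<le> l \<Longrightarrow> j < l \<Longrightarrow> (laplace_b ^^ j) (\<nu> (2*l)) = \<nu> (2*l - 2*j)"
    and "\<And>l. 1 \<le> l \<Longrightarrow> (laplace_b ^^ l) (\<nu> (2*l)) = dirac"
  shows "super_dirac n (superdist_class n (super_fundamental n \<nu>)) =
    superdist_class n (super_delta n)"
proof -
  let ?X = "fermionic_vector n :: 'm super_poly"
  define c :: "nat \<Rightarrow> real" where "c k = 2 * (4 ^ k * fact k / fact (n - k - 1))" for k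
  define d :: "nat \<Rightarrow> real" where "d k = 4 ^ k * fact k / fact (n - k)" for k
  \<comment> \<open>Three kinds of terms arise: \<open>P\<close> from fermionic differentiation of
    the odd powers, \<open>B\<close> from both sums, and \<open>L\<close> from the square of the
    bosonic operator.\<close>
  define P where "P k = \<nu> (2*k+2) \<otimes>\<^sub>s ?X ^ (2 * (n - k - 1))" for k
  define B where "B k = bosonic_dirac (\<nu> (2*k+2) \<otimes>\<^sub>s ?X ^ (2 * (n - k) - 1))" for k
  define L where "L k = laplace_b (\<nu> (2*k+2)) \<otimes>\<^sub>s ?X ^ (2 * (n - k))" for k
  have L0: "L 0 = dirac \<otimes>\<^sub>s ?X ^ (2 * n)"
    using assms(2)[of 1] by (simp add: L_def numeral_2_eq_2)
  \<comment> \<open>The recursion with \<open>l = k + 2\<close> and one Laplacian identifies the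
    shifted \<open>L\<close> terms with the \<open>P\<close> terms.\<close>
  have LSuc: "L (Suc k) = P k" for k
  proof -
    have idx: "2 * Suc k + 2 = 2 * (k + 2)" "2 * (k + 2) - 2 * 1 = 2 * k + 2" "n - Suc k = n - k - 1"
      by simp_all
    have "(laplace_b ^^ 1) (\<nu> (2 * (k + 2))) = \<nu> (2 * (k + 2) - 2 * 1)"
      by (rule assms(1)) simp_all
    then have "laplace_b (\<nu> (2 * Suc k + 2)) = \<nu> (2 * k + 2)"
      unfolding idx by simp
    then show ?thesis
      by (simp only: L_def P_def idx(3))
  qed
  \<comment> \<open>The first identity cancels the \<open>B\<close> terms of the two sums, the
    second cancels the \<open>P\<close> terms against the shifted \<open>L\<close> terms.\<close>
  have cd: "c k = d k * (2 * real (n - k))"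
    and dSuc: "c k * (2 * (real (n - k - 1) - real n)) = - d (Suc k)" if "k < n" for k
  proof -
    \<comment> \<open>Writing \<open>n\<close> as \<open>k + r + 1\<close> removes the truncated
      subtractions.\<close>
    obtain r where n: "n = Suc (k + r)" using \<open>k < n\<close> less_iff_Suc_add by auto
    then have r: "n - k = Suc r" "Suc r - 1 = r" "n - Suc k = r" "real n = real k + real r + 1"
      by simp_all
    show "c k = d k * (2 * real (n - k))"
      unfolding c_def d_def r fact_Suc of_nat_mult by (simp add: field_simps del: of_nat_Suc)
    show "c k * (2 * (real (n - k - 1) - real n)) = - d (Suc k)"
      unfolding c_def d_def r fact_Suc of_nat_mult power_Suc by (simp add: field_simps)
  qed
  have dirac_even: "free_super_dirac n (\<nu> (2*k+2) \<otimes>\<^sub>s ?X ^ (2*n - 2*k - 1)) \<simeq>\<^bsub>n\<^esub>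
      (2 * (real (n - k - 1) - real n)) *\<^sub>R P k - B k" if "k < n" for k
  proof -
    have "2*n - 2*k - 1 = Suc (2 * (n - k - 1))" "2 * (n - k) - 1 = Suc (2 * (n - k - 1))"
      using that by auto
    then show ?thesis unfolding P_def B_def by (simp only: super_dirac_odd_power)
  qed
  have dirac_odd: "free_super_dirac n (tensor_op (\<lambda>T. T) (\<lambda>a. a * ?X ^ (2*n - 2*k)) (odd_fundamental \<nu> k)) \<simeq>\<^bsub>n\<^esub>
      - ((2 * real (n - k)) *\<^sub>R B k) - L k" for k
    unfolding odd_fundamental_mult B_def L_def diff_mult_distrib2[symmetric]
    by (rule super_dirac_bosonic_even_power)
  let ?SB = "\<Sum>k<n. c k *\<^sub>R B k" and ?SP = "\<Sum>k<n. d (Suc k) *\<^sub>R P k"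
  have "(\<Sum>k<n. c k *\<^sub>R ((2 * (real (n - k - 1) - real n)) *\<^sub>R P k - B k)) = - ?SP - ?SB"
    unfolding sum_negf[symmetric] sum_subtractf[symmetric]
    by (intro sum.cong refl) (simp only: scaleR_diff_right scaleR_scaleR dSuc lessThan_iff scaleR_minus_left)
  moreover have "(\<Sum>k<n. c k *\<^sub>R free_super_dirac n (\<nu> (2*k+2) \<otimes>\<^sub>s ?X ^ (2*n - 2*k - 1))) \<simeq>\<^bsub>n\<^esub>
      (\<Sum>k<n. c k *\<^sub>R ((2 * (real (n - k - 1) - real n)) *\<^sub>R P k - B k))"
    by (rule superdist_cong_sum, rule superdist_cong_scaleR, rule dirac_even) simp
  ultimately have even_part: "(\<Sum>k<n. c k *\<^sub>R free_super_dirac n (\<nu> (2*k+2) \<otimes>\<^sub>s ?X ^ (2*n - 2*k - 1)))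
      \<simeq>\<^bsub>n\<^esub> - ?SP - ?SB"
    by metis
  have "(\<Sum>k\<le>n. d k *\<^sub>R (- ((2 * real (n - k)) *\<^sub>R B k) - L k))
      = - (\<Sum>k\<le>n. (d k * (2 * real (n - k))) *\<^sub>R B k) - (\<Sum>k\<le>n. d k *\<^sub>R L k)"
    by (simp only: scaleR_diff_right scaleR_minus_right scaleR_scaleR sum_subtractf sum_negf)
  \<comment> \<open>The term \<open>k = n\<close>, where the exponent in \<open>B\<close> is
    truncated, has coefficient 0.\<close>
  also have "(\<Sum>k\<le>n. (d k * (2 * real (n - k))) *\<^sub>R B k) = ?SB"
    unfolding lessThan_Suc_atMost[symmetric] sum.lessThan_Suc by (simp add: cd)
  \<comment> \<open>Splitting off \<open>k = 0\<close> isolates the Dirac term with coefficient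
    \<open>d 0 = 1 / fact n\<close>.\<close>
  also have "(\<Sum>k\<le>n. d k *\<^sub>R L k) = (1 / fact n) *\<^sub>R (dirac \<otimes>\<^sub>s ?X ^ (2 * n)) + ?SP"
    unfolding lessThan_Suc_atMost[symmetric] sum.lessThan_Suc_shift LSuc L0 by (simp add: d_def)
  finally have "(\<Sum>k\<le>n. d k *\<^sub>R (- ((2 * real (n - k)) *\<^sub>R B k) - L k))
      = - ?SB - ((1 / fact n) *\<^sub>R (dirac \<otimes>\<^sub>s ?X ^ (2 * n)) + ?SP)" .
  moreover have "(\<Sum>k\<le>n. d k *\<^sub>R free_super_dirac n
        (tensor_op (\<lambda>T. T) (\<lambda>a. a * ?X ^ (2*n - 2*k)) (odd_fundamental \<nu> k))) \<simeq>\<^bsub>n\<^esub>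
      (\<Sum>k\<le>n. d k *\<^sub>R (- ((2 * real (n - k)) *\<^sub>R B k) - L k))"
    by (rule superdist_cong_sum, rule superdist_cong_scaleR, rule dirac_odd)
  ultimately have odd_part: "(\<Sum>k\<le>n. d k *\<^sub>R free_super_dirac n
        (tensor_op (\<lambda>T. T) (\<lambda>a. a * ?X ^ (2*n - 2*k)) (odd_fundamental \<nu> k))) \<simeq>\<^bsub>n\<^esub>
      - ?SB - ((1 / fact n) *\<^sub>R (dirac \<otimes>\<^sub>s ?X ^ (2 * n)) + ?SP)"
    by metis
  have "free_super_dirac n (super_fundamental n \<nu>) =
      (\<Sum>k<n. c k *\<^sub>R free_super_dirac n (\<nu> (2*k+2) \<otimes>\<^sub>s ?X ^ (2*n - 2*k - 1))) -
      (\<Sum>k\<le>n. d k *\<^sub>R free_super_dirac n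
        (tensor_op (\<lambda>T. T) (\<lambda>a. a * ?X ^ (2*n - 2*k)) (odd_fundamental \<nu> k)))"
    unfolding super_fundamental_def c_def d_def
    by (simp only: linear_diff[OF linear_free_super_dirac] linear_sum[OF linear_free_super_dirac]
        linear_scale[OF linear_free_super_dirac])
  with superdist_cong_diff[OF even_part odd_part]
  have "free_super_dirac n (super_fundamental n \<nu>) \<simeq>\<^bsub>n\<^esub>
      (1 / fact n) *\<^sub>R (dirac \<otimes>\<^sub>s ?X ^ (2 * n))"
    by simp
  also have "\<dots> \<simeq>\<^bsub>n\<^esub> (1 / fact n) *\<^sub>R (dirac \<otimes>\<^sub>s (fact n *\<^sub>R prod_list (map gx [1..<2*n+1])))"
    by (intro superdist_cong_scaleR superdist_cong_tensor fermionic_vector_top_power)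
  also have "\<dots> = super_delta n"
    by (simp only: super_delta_def linear_scale[OF linear_tensor] scaleR_scaleR) simp
  finally have "free_super_dirac n (super_fundamental n \<nu>) \<simeq>\<^bsub>n\<^esub> super_delta n" .
  then show ?thesis
    unfolding super_dirac_class[OF super_fundamental_free_superdist]
    by (intro superdist_class_eqI free_super_dirac_closed super_fundamental_free_superdist
        super_delta_free_superdist)
qed

end
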